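(* Let $u,w\in\mathcal{D}(E)$ be such that $T=M_wEM_u$ is a bounded operator on $L^2(\Sigma)$. Then: (a) If $(E(|u|^2))^{\frac12}\,\bar{w}=u\,(E(|w|^2))^{\frac12}$, then $T$ is normal. (b) If $T$ is normal, then $|E(u)|^2E(|w|^2)=|E(w)|^2E(|u|^2)$.
   Context: $(X,\Sigma,\mu)$ is a complete $\sigma$-finite measure space and $\mathcal{A}\subseteq\Sigma$ is a $\sigma$-subalgebra such that $\mu|_{\mathcal{A}}$ is $\sigma$-finite. $L^2(\Sigma)=L^2(X,\Sigma,\mu)$ (complex-valued functions). $L^0(\Sigma)$ (resp. $L^0(\mathcal{A})$) denotes the a.e. finite valued $\Sigma$-measurable (resp. $\mathcal{A}$-measurable) functions modulo null sets. All equalities and inequalities between functions are up to $\mu$-null sets. $E=E^{\mathcal{A}}$ is the conditional expectation: for $f\ge 0$ measurable or $f\in L^2(\Sigma)$, $E(f)$ is the unique $\mathcal{A}$-measurable function with $\int_A f\,d\mu=\int_A E(f)\,d\mu$ for all $A\in\mathcal{A}$ (for which the integrals are defined). $\mathcal{D}(E)=\{g\in L^0(\Sigma): E(|g|)\in L^0(\mathcal{A})\}$, on which $E$ is defined by linearity. For $u,w\in\mathcal{D}(E)$, $M_wEM_u$ is the operator $f\mapsto wE(uf)$. An operator $T$ is normal if $T^*T=TT^*$. *)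

theory Defs
  imports "HOL-Probability.Probability"
begin

text \<open>
  Elements of \<open>L\<^sup>0\<close> and \<open>L\<^sup>2\<close> are represented by everywhere defined complex functions, and
  operators by maps on such functions; every identity between functions is stated almost everywhere.
\<close>

definition L2 :: "'a measure \<Rightarrow> ('a \<Rightarrow> complex) set" where
  "L2 M = {f \<in> borel_measurable M. integrable M (\<lambda>x. (cmod (f x))\<^sup>2)}"

definition L2_norm :: "'a measure \<Rightarrow> ('a \<Rightarrow> complex) \<Rightarrow> real" where
  "L2_norm M f = sqrt (LINT x|M. (cmod (f x))\<^sup>2)"

definition L2_inner :: "'a measure \<Rightarrow> ('a \<Rightarrow> complex) \<Rightarrow> ('a \<Rightarrow> complex) \<Rightarrow> complex" where
  "L2_inner M f g = (LINT x|M. f x * cnj (g x))"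

text \<open>
  A bounded linear operator on \<open>L\<^sup>2\<close>. Linearity and boundedness together make the map compatible
  with almost everywhere equality, so it descends to the quotient.
\<close>

definition bounded_L2_operator ::
    "'a measure \<Rightarrow> (('a \<Rightarrow> complex) \<Rightarrow> ('a \<Rightarrow> complex)) \<Rightarrow> bool" where
  "bounded_L2_operator M T \<longleftrightarrow>
     (\<forall>f\<in>L2 M. T f \<in> L2 M) \<and>
     (\<forall>f\<in>L2 M. \<forall>g\<in>L2 M. AE x in M. T (\<lambda>y. f y + g y) x = T f x + T g x) \<and>
     (\<forall>c. \<forall>f\<in>L2 M. AE x in M. T (\<lambda>y. c * f y) x = c * T f x) \<and>
     (\<exists>C. \<forall>f\<in>L2 M. L2_norm M (T f) \<le> C * L2_norm M f)"

definition is_L2_adjoint ::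
    "'a measure \<Rightarrow> (('a \<Rightarrow> complex) \<Rightarrow> ('a \<Rightarrow> complex)) \<Rightarrow>
      (('a \<Rightarrow> complex) \<Rightarrow> ('a \<Rightarrow> complex)) \<Rightarrow> bool" where
  "is_L2_adjoint M T S \<longleftrightarrow>
     bounded_L2_operator M S \<and>
     (\<forall>f\<in>L2 M. \<forall>g\<in>L2 M. L2_inner M (T f) g = L2_inner M f (S g))"

text \<open>
  The adjoint of a bounded operator exists by the Riesz representation theorem, and \<open>S f\<close> is
  determined almost everywhere by \<open>T\<close> and \<open>f\<close>; so the existential quantifier just names \<open>T\<^sup>*\<close>.
\<close>

definition normal_L2_operator ::
    "'a measure \<Rightarrow> (('a \<Rightarrow> complex) \<Rightarrow> ('a \<Rightarrow> complex)) \<Rightarrow> bool" where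
  "normal_L2_operator M T \<longleftrightarrow>
     bounded_L2_operator M T \<and>
     (\<exists>S. is_L2_adjoint M T S \<and> (\<forall>f\<in>L2 M. AE x in M. S (T f) x = T (S f) x))"

definition cond_exp_domain :: "'a measure \<Rightarrow> 'a measure \<Rightarrow> ('a \<Rightarrow> complex) set" where
  "cond_exp_domain M F =
     {g \<in> borel_measurable M. AE x in M. nn_cond_exp M F (\<lambda>y. ennreal (cmod (g y))) x < \<infinity>}"

text \<open>
  The library's \<open>real_cond_exp\<close> is the difference of the conditional expectations of the positive
  and negative parts, so this is the extension of \<open>E\<close> by linearity on \<^const>\<open>cond_exp_domain\<close>.
\<close>

definition complex_cond_exp ::
    "'a measure \<Rightarrow> 'a measure \<Rightarrow> ('a \<Rightarrow> complex) \<Rightarrow> ('a \<Rightarrow> complex)" where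
  "complex_cond_exp M F g x =
     Complex (real_cond_exp M F (\<lambda>y. Re (g y)) x) (real_cond_exp M F (\<lambda>y. Im (g y)) x)"

text \<open>
  \<open>E(|g|\<^sup>2)\<close> may be infinite for \<open>g\<close> in \<^const>\<open>cond_exp_domain\<close>, hence its values in \<^typ>\<open>ennreal\<close>.
\<close>

definition cond_exp_sq ::
    "'a measure \<Rightarrow> 'a measure \<Rightarrow> ('a \<Rightarrow> complex) \<Rightarrow> ('a \<Rightarrow> ennreal)" where
  "cond_exp_sq M F g = nn_cond_exp M F (\<lambda>y. ennreal ((cmod (g y))\<^sup>2))"

text \<open>
  \<open>(E(|g|\<^sup>2))\<^bsup>1/2\<^esup>\<close> as a real number, with value 0 where \<open>E(|g|\<^sup>2)\<close> is infinite. It is only used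
  when \<open>f \<mapsto> w E(u f)\<close> is bounded on \<open>L\<^sup>2\<close>. Then \<open>E(|u|\<^sup>2) E(|w|\<^sup>2)\<close> is essentially bounded, so that
  \<open>w = 0\<close> almost everywhere on \<open>{E(|u|\<^sup>2) = \<infinity>}\<close> and \<open>u = 0\<close> almost everywhere on
  \<open>{E(|w|\<^sup>2) = \<infinity>}\<close>; since this root is multiplied by \<open>w\<close>, respectively \<open>u\<close>, this is the
  convention \<open>0 \<cdot> \<infinity> = 0\<close> (which is also that of \<^typ>\<open>ennreal\<close>).
\<close>

definition cond_exp_sq_root ::
    "'a measure \<Rightarrow> 'a measure \<Rightarrow> ('a \<Rightarrow> complex) \<Rightarrow> ('a \<Rightarrow> real)" where
  "cond_exp_sq_root M F g x = sqrt (enn2real (cond_exp_sq M F g x))"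

definition weighted_cond_exp ::
    "'a measure \<Rightarrow> 'a measure \<Rightarrow> ('a \<Rightarrow> complex) \<Rightarrow> ('a \<Rightarrow> complex) \<Rightarrow>
      ('a \<Rightarrow> complex) \<Rightarrow> ('a \<Rightarrow> complex)" where
  "weighted_cond_exp M F w u f x = w x * complex_cond_exp M F (\<lambda>y. u y * f y) x"

end

theory Submission
  imports Defs
begin

text \<open>
  Write \<open>E\<close> for the conditional expectation, \<open>U = E(|u|\<^sup>2)\<close>, \<open>W = E(|w|\<^sup>2)\<close>, and \<open>T f = w E(u f)\<close>.

  Suppose first that \<open>U\<close> and \<open>W\<close> are finite and \<open>U W \<le> K\<close> almost everywhere. The conditional
  Cauchy--Schwarz inequality \<open>|E(u f)|\<^sup>2 \<le> U E(|f|\<^sup>2)\<close> makes \<open>f \<mapsto> w E(u f)\<close> bounded, and moving the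
  \<open>F\<close>-measurable factor \<open>E(u f)\<close> in and out of \<open>E\<close> shows that its adjoint is
  \<open>S f = cnj u E(cnj w f)\<close>. Pulling out \<open>F\<close>-measurable factors once more gives
  \<open>T S f = w U E(cnj w f)\<close> and \<open>S T f = cnj u W E(u f)\<close>, so \<open>T\<close> is normal if and only if, for all
  square integrable \<open>f\<close>,

    \<open>w U E(cnj w f) = cnj u W E(u f)\<close>   almost everywhere  (\<open>normal_iff\<close>).

  If \<open>\<surd>U cnj w = u \<surd>W\<close>, then one factor \<open>\<surd>U\<close> on the left can be moved into \<open>E\<close>, where it turns
  \<open>cnj w\<close> into \<open>u\<close>, and the other turns \<open>w\<close> into \<open>cnj u\<close>; this is the relation. Conversely, apply
  the relation to a strictly positive \<open>F\<close>-measurable \<open>f\<close>, cancel \<open>f\<close> to get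
  \<open>w U E(cnj w) = cnj u W E(u)\<close>, and take \<open>E\<close> of both sides: \<open>U |E(w)|\<^sup>2 = W |E(u)|\<^sup>2\<close>.

  In general \<open>U\<close> and \<open>W\<close> may be infinite. Testing the bound on \<open>T\<close> with truncations of \<open>cnj u\<close>
  localised to sets of \<open>F\<close> still gives \<open>U W \<le> K\<close> (\<open>cond_exp_sq_bound_if_bounded\<close>). Hence \<open>u = 0\<close>
  where \<open>W = \<infinity>\<close> and \<open>w = 0\<close> where \<open>U = \<infinity>\<close>, so multiplying both weights by the indicator of
  \<open>{U < \<infinity>, W < \<infinity>}\<close>, a set of \<open>F\<close>, does not change \<open>T\<close>; and off that set both sides of either
  identity vanish.
\<close>

section \<open>Conditional expectation of extended nonnegative functions\<close>

context sigma_finite_subalgebra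
begin

lemma obtain_positive_integrable_subalg:
  obtains p :: "'a \<Rightarrow> real" where "p \<in> borel_measurable F" "\<And>x. p x > 0" "integrable M p"
proof -
  obtain p :: "'a \<Rightarrow> real" where p: "p \<in> borel_measurable (restr_to_subalg M F)" "\<And>x. p x > 0"
      "integrable (restr_to_subalg M F) p"
    using sigma_finite_measure.obtain_positive_integrable_function[OF sigma_fin_subalg] by metis
  show thesis
    using that[of p] measurable_in_subalg'[OF subalg p(1)] p(2) integrable_from_subalg[OF subalg p(3)]
    by blast
qed

lemma nn_cond_exp_finite:
  assumes [measurable]: "k \<in> borel_measurable M" and fin: "(\<integral>\<^sup>+x. k x \<partial>M) \<noteq> \<infinity>"
  shows "AE x in M. nn_cond_exp M F k x < \<infinity>"
proof -
  have "(\<integral>\<^sup>+x. nn_cond_exp M F k x \<partial>M) = (\<integral>\<^sup>+x. k x \<partial>M)"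
    using nn_cond_exp_intg[of "\<lambda>_. 1" k] by simp
  then have "AE x in M. nn_cond_exp M F k x \<noteq> \<infinity>"
    using fin by (intro nn_integral_noteq_infinite) auto
  then show ?thesis by (simp add: less_top)
qed

text \<open>
  Over the set \<open>P\<close>, which belongs to \<open>F\<close>, the integrals of \<open>k\<close> and of its conditional expectation
  agree; so \<open>k\<close> is nonnegative with integral 0 there.
\<close>

lemma AE_zero_if_nn_cond_exp_zero:
  assumes [measurable]: "k \<in> borel_measurable M" and P: "Measurable.pred F P"
    and zero: "AE x in M. P x \<longrightarrow> nn_cond_exp M F k x = 0"
  shows "AE x in M. P x \<longrightarrow> k x = 0"
proof -
  have [measurable]: "Measurable.pred F P" by (rule P)
  have [measurable]: "Measurable.pred M P"
    by (rule measurable_from_subalg[OF subalg P])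
  let ?i = "\<lambda>x. if P x then 1 else (0::ennreal)"
  have "(\<integral>\<^sup>+x. ?i x * k x \<partial>M) = (\<integral>\<^sup>+x. ?i x * nn_cond_exp M F k x \<partial>M)"
    by (rule nn_cond_exp_intg[symmetric]) measurable
  also have "\<dots> = (\<integral>\<^sup>+x. 0 \<partial>M)"
    by (rule nn_integral_cong_AE) (use zero in auto)
  finally have "(\<integral>\<^sup>+x. ?i x * k x \<partial>M) = 0" by simp
  then have "AE x in M. ?i x * k x = 0"
    by (subst (asm) nn_integral_0_iff_AE) auto
  then show ?thesis by eventually_elim (auto split: if_splits)
qed

text \<open>
  Conditional monotone convergence: the ordinary theorem, applied over each set of \<open>F\<close>, shows that
  the supremum has the integrals that characterise the conditional expectation.
\<close>

lemma nn_cond_exp_SUP: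
  assumes [measurable]: "\<And>n::nat. k n \<in> borel_measurable M" and inc: "incseq k"
  shows "AE x in M. nn_cond_exp M F (\<lambda>x. SUP n. k n x) x = (SUP n. nn_cond_exp M F (k n) x)"
proof -
  have "AE x in M. \<forall>n. nn_cond_exp M F (k n) x \<le> nn_cond_exp M F (k (Suc n)) x"
    unfolding AE_all_countable
    by (intro allI nn_cond_exp_mono) (use inc in \<open>auto simp: incseq_Suc_iff le_fun_def\<close>)
  then have mono: "AE x in M. \<forall>A. \<forall>n. indicator A x * nn_cond_exp M F (k n) x
      \<le> (indicator A x * nn_cond_exp M F (k (Suc n)) x :: ennreal)"
    by eventually_elim (auto intro: mult_left_mono)
  have "AE x in M. (SUP n. nn_cond_exp M F (k n) x) = nn_cond_exp M F (\<lambda>x. SUP n. k n x) x"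
  proof (rule nn_cond_exp_charact)
    fix A assume A [measurable]: "A \<in> sets F"
    have [measurable]: "A \<in> sets M" using A subalg by (auto simp: subalgebra_def)
    have "(\<integral>\<^sup>+x\<in>A. (SUP n. k n x) \<partial>M) = (\<integral>\<^sup>+x. (SUP n. indicator A x * k n x) \<partial>M)"
      by (simp add: SUP_mult_left_ennreal mult.commute)
    also have "\<dots> = (SUP n. \<integral>\<^sup>+x. indicator A x * k n x \<partial>M)"
      by (rule nn_integral_monotone_convergence_SUP)
        (use inc in \<open>auto simp: incseq_def le_fun_def intro: mult_left_mono\<close>)
    also have "\<dots> = (SUP n. \<integral>\<^sup>+x. indicator A x * nn_cond_exp M F (k n) x \<partial>M)"
      by (subst nn_cond_exp_intg) auto
    also have "\<dots> = (\<integral>\<^sup>+x. (SUP n. indicator A x * nn_cond_exp M F (k n) x) \<partial>M)"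
      by (rule nn_integral_monotone_convergence_SUP_AE[symmetric]) (use mono in auto)
    also have "\<dots> = (\<integral>\<^sup>+x\<in>A. (SUP n. nn_cond_exp M F (k n) x) \<partial>M)"
      by (simp add: SUP_mult_left_ennreal mult.commute)
    finally show "(\<integral>\<^sup>+x\<in>A. (SUP n. k n x) \<partial>M) = (\<integral>\<^sup>+x\<in>A. (SUP n. nn_cond_exp M F (k n) x) \<partial>M)" .
  qed auto
  then show ?thesis by (auto elim: eventually_mono)
qed

end

section \<open>The complex conditional expectation on its natural domain\<close>

lemma borel_measurable_cnj [measurable (raw)]:
  "f \<in> borel_measurable N \<Longrightarrow> (\<lambda>x. cnj (f x)) \<in> borel_measurable N"
  by (rule borel_measurable_continuous_on[where f = cnj]) (intro continuous_intros)+

context sigma_finite_subalgebra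
begin

text \<open>
  A function with finite conditional expectation need not be integrable, but it becomes integrable
  after multiplication by a strictly positive \<open>F\<close>-measurable weight. Such a weight can be cancelled
  after conditioning, which extends identities from integrable functions to all of
  \<^const>\<open>cond_exp_domain\<close>. The weight is \<open>p / (1 + E(k))\<close> with \<open>p\<close> positive and integrable.
\<close>

lemma obtain_localizing_weight:
  fixes k :: "'a \<Rightarrow> real"
  assumes [measurable]: "k \<in> borel_measurable M" and nonneg: "\<And>x. k x \<ge> 0"
    and fin: "AE x in M. nn_cond_exp M F (\<lambda>y. ennreal (k y)) x < \<infinity>"
  obtains h where "h \<in> borel_measurable F" "\<And>x. h x > 0" "integrable M (\<lambda>x. h x * k x)"
proof -
  obtain p :: "'a \<Rightarrow> real" where p [measurable]: "p \<in> borel_measurable F" and p_pos: "\<And>x. p x > 0"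
      and p_int: "integrable M p"
    by (rule obtain_positive_integrable_subalg) blast
  define e where "e = nn_cond_exp M F (\<lambda>y. ennreal (k y))"
  have [measurable]: "e \<in> borel_measurable F" by (simp add: e_def)
  define h where "h x = p x / (1 + enn2real (e x))" for x
  have h [measurable]: "h \<in> borel_measurable F" unfolding h_def by measurable
  note [measurable] = measurable_from_subalg[OF subalg h]
  have h_pos: "h x > 0" for x
    using p_pos[of x] by (simp add: h_def add_pos_nonneg)
  have "(\<integral>\<^sup>+x. ennreal (h x) * ennreal (k x) \<partial>M) = (\<integral>\<^sup>+x. ennreal (h x) * e x \<partial>M)"
    unfolding e_def by (rule nn_cond_exp_intg[symmetric]) auto
  also have "\<dots> \<le> (\<integral>\<^sup>+x. ennreal (p x) \<partial>M)"
  proof (rule nn_integral_mono_AE, use fin in eventually_elim)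
    case (elim x)
    then obtain r where r: "e x = ennreal r" "r \<ge> 0"
      by (cases "e x") (auto simp: e_def)
    have "h x * r \<le> p x"
      using r p_pos[of x] by (simp add: h_def field_simps)
    then show ?case using r h_pos[of x] less_imp_le[OF h_pos[of x]]
      by (simp add: ennreal_mult[symmetric] ennreal_leI)
  qed
  also have "\<dots> < \<infinity>"
    using p_int by (subst nn_integral_eq_integral) (auto simp: less_imp_le p_pos)
  finally have "integrable M (\<lambda>x. h x * k x)"
    by (intro integrableI_bounded)
      (auto simp: abs_mult nonneg less_imp_le[OF h_pos] ennreal_mult)
  then show thesis using that h h_pos by blast
qed

lemma cond_exp_domain_measurable: "f \<in> cond_exp_domain M F \<Longrightarrow> f \<in> borel_measurable M"
  by (simp add: cond_exp_domain_def)

lemma cond_exp_domain_mono: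
  assumes g: "g \<in> cond_exp_domain M F" and [measurable]: "f \<in> borel_measurable M"
    and le: "AE x in M. cmod (f x) \<le> cmod (g x)"
  shows "f \<in> cond_exp_domain M F"
proof -
  have [measurable]: "g \<in> borel_measurable M" using g by (rule cond_exp_domain_measurable)
  have "AE x in M. nn_cond_exp M F (\<lambda>y. ennreal (cmod (f y))) x
      \<le> nn_cond_exp M F (\<lambda>y. ennreal (cmod (g y))) x"
    using le by (intro nn_cond_exp_mono) (auto intro: ennreal_leI elim: eventually_mono)
  moreover have "AE x in M. nn_cond_exp M F (\<lambda>y. ennreal (cmod (g y))) x < \<infinity>"
    using g by (simp add: cond_exp_domain_def)
  ultimately have "AE x in M. nn_cond_exp M F (\<lambda>y. ennreal (cmod (f y))) x < \<infinity>"
    by eventually_elim (rule le_less_trans)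
  then show ?thesis by (simp add: cond_exp_domain_def)
qed

lemma cond_exp_domain_mult:
  assumes a [measurable]: "a \<in> borel_measurable F" and f: "f \<in> cond_exp_domain M F"
  shows "(\<lambda>x. a x * f x) \<in> cond_exp_domain M F"
proof -
  note [measurable] = cond_exp_domain_measurable[OF f] measurable_from_subalg[OF subalg a]
  have "AE x in M. ennreal (cmod (a x)) * nn_cond_exp M F (\<lambda>y. ennreal (cmod (f y))) x
      = nn_cond_exp M F (\<lambda>y. ennreal (cmod (a y)) * ennreal (cmod (f y))) x"
    by (rule nn_cond_exp_prod) auto
  moreover have "AE x in M. nn_cond_exp M F (\<lambda>y. ennreal (cmod (f y))) x < \<infinity>"
    using f by (simp add: cond_exp_domain_def)
  ultimately have "AE x in M. nn_cond_exp M F (\<lambda>y. ennreal (cmod (a y * f y))) x < \<infinity>"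
  proof eventually_elim
    case (elim x)
    then show ?case by (auto simp: norm_mult ennreal_mult ennreal_mult_less_top simp flip: elim(1))
  qed
  then show ?thesis by (simp add: cond_exp_domain_def)
qed

text \<open>
  A common majorant of \<open>f\<close> and \<open>g\<close> in the domain: one weight that makes it integrable makes both
  functions integrable.
\<close>

lemma cond_exp_domain_add_norm:
  assumes f: "f \<in> cond_exp_domain M F" and g: "g \<in> cond_exp_domain M F"
  shows "(\<lambda>x. complex_of_real (cmod (f x) + cmod (g x))) \<in> cond_exp_domain M F"
proof -
  note [measurable] = cond_exp_domain_measurable[OF f] cond_exp_domain_measurable[OF g]
  have "AE x in M. nn_cond_exp M F (\<lambda>y. ennreal (cmod (f y))) x
      + nn_cond_exp M F (\<lambda>y. ennreal (cmod (g y))) x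
      = nn_cond_exp M F (\<lambda>y. ennreal (cmod (f y)) + ennreal (cmod (g y))) x"
    by (rule nn_cond_exp_sum) auto
  moreover have "AE x in M. nn_cond_exp M F (\<lambda>y. ennreal (cmod (f y))) x < \<infinity>"
      "AE x in M. nn_cond_exp M F (\<lambda>y. ennreal (cmod (g y))) x < \<infinity>"
    using f g by (simp_all add: cond_exp_domain_def)
  ultimately have "AE x in M. nn_cond_exp M F (\<lambda>y. ennreal (cmod (f y) + cmod (g y))) x < \<infinity>"
  proof eventually_elim
    case (elim x)
    then show ?case by (simp flip: elim(1))
  qed
  then show ?thesis
    by (simp add: cond_exp_domain_def abs_of_nonneg del: of_real_add)
qed

lemma cond_exp_domain_add:
  assumes f: "f \<in> cond_exp_domain M F" and g: "g \<in> cond_exp_domain M F"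
  shows "(\<lambda>x. f x + g x) \<in> cond_exp_domain M F"
proof (rule cond_exp_domain_mono[OF cond_exp_domain_add_norm[OF f g]])
  note [measurable] = cond_exp_domain_measurable[OF f] cond_exp_domain_measurable[OF g]
  show "(\<lambda>x. f x + g x) \<in> borel_measurable M" by measurable
  show "AE x in M. cmod (f x + g x) \<le> cmod (complex_of_real (cmod (f x) + cmod (g x)))"
    unfolding norm_of_real by (intro AE_I2) (simp add: abs_of_nonneg norm_triangle_ineq)
qed

lemma real_cond_exp_mult_domain:
  fixes a f :: "'a \<Rightarrow> real"
  assumes a [measurable]: "a \<in> borel_measurable F" and [measurable]: "f \<in> borel_measurable M"
    and f: "(\<lambda>x. complex_of_real (f x)) \<in> cond_exp_domain M F"
  shows "AE x in M. real_cond_exp M F (\<lambda>y. a y * f y) x = a x * real_cond_exp M F f x"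
proof -
  note aM [measurable] = measurable_from_subalg[OF subalg a]
  \<comment> \<open>The weight has to make both \<open>f\<close> and \<open>a f\<close> integrable, so it is chosen for \<open>(1 + |a|) |f|\<close>.\<close>
  have "(\<lambda>x. complex_of_real (1 + \<bar>a x\<bar>) * complex_of_real (f x)) \<in> cond_exp_domain M F"
    by (rule cond_exp_domain_mult[OF _ f]) measurable
  then have "AE x in M. nn_cond_exp M F (\<lambda>y. ennreal ((1 + \<bar>a y\<bar>) * \<bar>f y\<bar>)) x < \<infinity>"
    by (simp add: cond_exp_domain_def norm_mult del: of_real_add)
  then obtain h where h [measurable]: "h \<in> borel_measurable F" and h_pos: "\<And>x. h x > 0"
      and h_int: "integrable M (\<lambda>x. h x * ((1 + \<bar>a x\<bar>) * \<bar>f x\<bar>))"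
    by (rule obtain_localizing_weight[rotated 2]) auto
  note [measurable] = measurable_from_subalg[OF subalg h]
  have int2: "integrable M (\<lambda>x. h x * (a x * f x))"
    by (rule Bochner_Integration.integrable_bound[OF h_int])
      (auto simp: abs_mult intro!: mult_left_mono mult_right_mono AE_I2)
  then have int3: "integrable M (\<lambda>x. (h x * a x) * f x)" by (simp add: mult.assoc)
  have "AE x in M. real_cond_exp M F (\<lambda>x. h x * (a x * f x)) x
      = h x * real_cond_exp M F (\<lambda>y. a y * f y) x"
    by (rule real_cond_exp_mult[OF h _ int2]) measurable
  moreover have "AE x in M. real_cond_exp M F (\<lambda>x. (h x * a x) * f x) x
      = (h x * a x) * real_cond_exp M F f x"
    by (rule real_cond_exp_mult[OF _ _ int3]) measurable
  ultimately show ?thesis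
  proof eventually_elim
    case (elim x)
    then have "h x * real_cond_exp M F (\<lambda>y. a y * f y) x = h x * (a x * real_cond_exp M F f x)"
      by (simp add: mult.assoc)
    then show ?case using h_pos[of x] by simp
  qed
qed

lemma real_cond_exp_add_domain:
  fixes f g :: "'a \<Rightarrow> real"
  assumes [measurable]: "f \<in> borel_measurable M" "g \<in> borel_measurable M"
    and f: "(\<lambda>x. complex_of_real (f x)) \<in> cond_exp_domain M F"
    and g: "(\<lambda>x. complex_of_real (g x)) \<in> cond_exp_domain M F"
  shows "AE x in M. real_cond_exp M F (\<lambda>y. f y + g y) x
    = real_cond_exp M F f x + real_cond_exp M F g x"
proof -
  have "AE x in M. nn_cond_exp M F (\<lambda>y. ennreal (\<bar>f y\<bar> + \<bar>g y\<bar>)) x < \<infinity>"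
    using cond_exp_domain_add_norm[OF f g]
    by (simp add: cond_exp_domain_def abs_of_nonneg del: of_real_add)
  then obtain h where h [measurable]: "h \<in> borel_measurable F" and h_pos: "\<And>x. h x > 0"
      and h_int: "integrable M (\<lambda>x. h x * (\<bar>f x\<bar> + \<bar>g x\<bar>))"
    by (rule obtain_localizing_weight[rotated 2]) auto
  note [measurable] = measurable_from_subalg[OF subalg h]
  have int1: "integrable M (\<lambda>x. h x * f x)" and int2: "integrable M (\<lambda>x. h x * g x)"
    by (rule Bochner_Integration.integrable_bound[OF h_int];
      auto simp: abs_mult abs_of_nonneg intro!: mult_left_mono)+
  have int3: "integrable M (\<lambda>x. h x * (f x + g x))"
    using Bochner_Integration.integrable_add[OF int1 int2] by (simp add: distrib_left)
  have "AE x in M. real_cond_exp M F (\<lambda>x. h x * (f x + g x)) x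
      = h x * real_cond_exp M F (\<lambda>y. f y + g y) x"
    by (rule real_cond_exp_mult[OF h _ int3]) measurable
  moreover have "AE x in M. real_cond_exp M F (\<lambda>x. h x * f x) x = h x * real_cond_exp M F f x"
    by (rule real_cond_exp_mult[OF h _ int1]) measurable
  moreover have "AE x in M. real_cond_exp M F (\<lambda>x. h x * g x) x = h x * real_cond_exp M F g x"
    by (rule real_cond_exp_mult[OF h _ int2]) measurable
  moreover have "AE x in M. real_cond_exp M F (\<lambda>x. h x * f x + h x * g x) x
      = real_cond_exp M F (\<lambda>x. h x * f x) x + real_cond_exp M F (\<lambda>x. h x * g x) x"
    by (rule real_cond_exp_add[OF int1 int2])
  ultimately show ?thesis
  proof eventually_elim
    case (elim x)
    then have "h x * real_cond_exp M F (\<lambda>y. f y + g y) x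
        = h x * (real_cond_exp M F f x + real_cond_exp M F g x)"
      by (simp add: distrib_left)
    then show ?case using h_pos[of x] by simp
  qed
qed

lemma complex_cond_exp_altdef:
  "complex_cond_exp M F f x = complex_of_real (real_cond_exp M F (\<lambda>y. Re (f y)) x)
    + \<i> * complex_of_real (real_cond_exp M F (\<lambda>y. Im (f y)) x)"
  by (simp add: complex_cond_exp_def complex_eq_iff)

lemma Re_complex_cond_exp: "Re (complex_cond_exp M F f x) = real_cond_exp M F (\<lambda>y. Re (f y)) x"
  and Im_complex_cond_exp: "Im (complex_cond_exp M F f x) = real_cond_exp M F (\<lambda>y. Im (f y)) x"
  by (simp_all add: complex_cond_exp_def)

lemma borel_measurable_complex_cond_exp [measurable]:
  "complex_cond_exp M F f \<in> borel_measurable F"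
  unfolding complex_cond_exp_altdef[abs_def] by measurable

lemma borel_measurable_complex_cond_exp2 [measurable]:
  "complex_cond_exp M F f \<in> borel_measurable M"
  by (rule measurable_from_subalg[OF subalg borel_measurable_complex_cond_exp])

lemma complex_cond_exp_cong:
  assumes "AE x in M. f x = g x" and [measurable]: "f \<in> borel_measurable M" "g \<in> borel_measurable M"
  shows "AE x in M. complex_cond_exp M F f x = complex_cond_exp M F g x"
proof -
  have "AE x in M. real_cond_exp M F (\<lambda>y. Re (f y)) x = real_cond_exp M F (\<lambda>y. Re (g y)) x"
      "AE x in M. real_cond_exp M F (\<lambda>y. Im (f y)) x = real_cond_exp M F (\<lambda>y. Im (g y)) x"
    by (rule real_cond_exp_cong; use assms(1) in \<open>auto elim: eventually_mono\<close>)+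
  then show ?thesis by eventually_elim (simp add: complex_cond_exp_def)
qed

lemma cond_exp_domain_Re:
  "f \<in> cond_exp_domain M F \<Longrightarrow> (\<lambda>x. complex_of_real (Re (f x))) \<in> cond_exp_domain M F"
  by (frule cond_exp_domain_measurable, erule cond_exp_domain_mono) (auto simp: abs_Re_le_cmod)

lemma cond_exp_domain_Im:
  "f \<in> cond_exp_domain M F \<Longrightarrow> (\<lambda>x. complex_of_real (Im (f x))) \<in> cond_exp_domain M F"
  by (frule cond_exp_domain_measurable, erule cond_exp_domain_mono) (auto simp: abs_Im_le_cmod)

lemma complex_cond_exp_add:
  assumes f: "f \<in> cond_exp_domain M F" and g: "g \<in> cond_exp_domain M F"
  shows "AE x in M. complex_cond_exp M F (\<lambda>y. f y + g y) x
    = complex_cond_exp M F f x + complex_cond_exp M F g x"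
proof -
  note [measurable] = cond_exp_domain_measurable[OF f] cond_exp_domain_measurable[OF g]
  have "AE x in M. real_cond_exp M F (\<lambda>y. Re (f y) + Re (g y)) x
      = real_cond_exp M F (\<lambda>y. Re (f y)) x + real_cond_exp M F (\<lambda>y. Re (g y)) x"
    by (rule real_cond_exp_add_domain) (auto intro: cond_exp_domain_Re f g)
  moreover have "AE x in M. real_cond_exp M F (\<lambda>y. Im (f y) + Im (g y)) x
      = real_cond_exp M F (\<lambda>y. Im (f y)) x + real_cond_exp M F (\<lambda>y. Im (g y)) x"
    by (rule real_cond_exp_add_domain) (auto intro: cond_exp_domain_Im f g)
  ultimately show ?thesis
    by eventually_elim (simp add: complex_eq_iff complex_cond_exp_def)
qed

lemma complex_cond_exp_mult:
  assumes a [measurable]: "a \<in> borel_measurable F" and f: "f \<in> cond_exp_domain M F"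
  shows "AE x in M. complex_cond_exp M F (\<lambda>y. a y * f y) x = a x * complex_cond_exp M F f x"
proof -
  note [measurable] = cond_exp_domain_measurable[OF f] measurable_from_subalg[OF subalg a]
  have dom: "(\<lambda>x. complex_of_real (b x * c x)) \<in> cond_exp_domain M F"
    if "b \<in> borel_measurable F" "(\<lambda>x. complex_of_real (c x)) \<in> cond_exp_domain M F" for b c
    using cond_exp_domain_mult[of "\<lambda>x. complex_of_real (b x)" "\<lambda>x. complex_of_real (c x)"] that
    by simp
  note Re = cond_exp_domain_Re[OF f] and Im = cond_exp_domain_Im[OF f]
  have "AE x in M. real_cond_exp M F (\<lambda>y. Re (a y) * Re (f y) + (- Im (a y)) * Im (f y)) x
      = real_cond_exp M F (\<lambda>y. Re (a y) * Re (f y)) x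
        + real_cond_exp M F (\<lambda>y. (- Im (a y)) * Im (f y)) x"
    by (rule real_cond_exp_add_domain[OF _ _ dom[OF _ Re] dom[OF _ Im]]) measurable
  moreover have "AE x in M. real_cond_exp M F (\<lambda>y. Re (a y) * Im (f y) + Im (a y) * Re (f y)) x
      = real_cond_exp M F (\<lambda>y. Re (a y) * Im (f y)) x
        + real_cond_exp M F (\<lambda>y. Im (a y) * Re (f y)) x"
    by (rule real_cond_exp_add_domain[OF _ _ dom[OF _ Im] dom[OF _ Re]]) measurable
  moreover have "AE x in M. real_cond_exp M F (\<lambda>y. Re (a y) * Re (f y)) x
      = Re (a x) * real_cond_exp M F (\<lambda>y. Re (f y)) x"
    by (rule real_cond_exp_mult_domain) (auto intro: cond_exp_domain_Re f)
  moreover have "AE x in M. real_cond_exp M F (\<lambda>y. (- Im (a y)) * Im (f y)) x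
      = (- Im (a x)) * real_cond_exp M F (\<lambda>y. Im (f y)) x"
    by (rule real_cond_exp_mult_domain) (auto intro: cond_exp_domain_Im f)
  moreover have "AE x in M. real_cond_exp M F (\<lambda>y. Re (a y) * Im (f y)) x
      = Re (a x) * real_cond_exp M F (\<lambda>y. Im (f y)) x"
    by (rule real_cond_exp_mult_domain) (auto intro: cond_exp_domain_Im f)
  moreover have "AE x in M. real_cond_exp M F (\<lambda>y. Im (a y) * Re (f y)) x
      = Im (a x) * real_cond_exp M F (\<lambda>y. Re (f y)) x"
    by (rule real_cond_exp_mult_domain) (auto intro: cond_exp_domain_Re f)
  ultimately show ?thesis
    by eventually_elim (simp add: complex_eq_iff complex_cond_exp_def)
qed

lemma complex_cond_exp_cnj:
  "complex_cond_exp M F (\<lambda>y. cnj (f y)) x = cnj (complex_cond_exp M F f x)"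
  by (simp add: complex_cond_exp_def complex_eq_iff real_cond_exp_def)

lemma integrable_complex_cond_exp:
  assumes f: "integrable M f"
  shows "integrable M (complex_cond_exp M F f)"
proof -
  have "integrable M (real_cond_exp M F (\<lambda>y. Re (f y)))" "integrable M (real_cond_exp M F (\<lambda>y. Im (f y)))"
    using f by (auto intro!: real_cond_exp_int(1))
  then show ?thesis unfolding complex_cond_exp_altdef[abs_def] by auto
qed

lemma integral_complex_cond_exp:
  assumes f: "integrable M f"
  shows "(LINT x|M. complex_cond_exp M F f x) = (LINT x|M. f x)"
proof -
  have "Re (LINT x|M. complex_cond_exp M F f x) = Re (LINT x|M. f x)"
    using real_cond_exp_int(2)[OF integrable_Re[OF f]]
      integral_Re[OF integrable_complex_cond_exp[OF f]] integral_Re[OF f]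
    by (simp add: Re_complex_cond_exp)
  moreover have "Im (LINT x|M. complex_cond_exp M F f x) = Im (LINT x|M. f x)"
    using real_cond_exp_int(2)[OF integrable_Im[OF f]]
      integral_Im[OF integrable_complex_cond_exp[OF f]] integral_Im[OF f]
    by (simp add: Im_complex_cond_exp)
  ultimately show ?thesis by (simp add: complex_eq_iff)
qed

lemma complex_cond_exp_of_nonneg:
  fixes f :: "'a \<Rightarrow> real"
  assumes [measurable]: "f \<in> borel_measurable M" and nonneg: "\<And>x. f x \<ge> 0"
  shows "AE x in M. complex_cond_exp M F (\<lambda>y. complex_of_real (f y)) x
    = complex_of_real (enn2real (nn_cond_exp M F (\<lambda>y. ennreal (f y)) x))"
proof -
  have "AE x in M. 0 = nn_cond_exp M F (\<lambda>_. 0) x"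
    by (rule nn_cond_exp_F_meas) simp
  then show ?thesis
    by eventually_elim
      (use nonneg in \<open>simp add: complex_eq_iff complex_cond_exp_def real_cond_exp_def ennreal_neg\<close>)
qed

text \<open>
  Rotate \<open>f\<close> by the \<open>F\<close>-measurable phase \<open>a = sgn (cnj (E f))\<close>: then \<open>E(a f) = |E f|\<close> is real, so it
  equals \<open>E(Re (a f))\<close>, and \<open>|Re (a f)| \<le> |f|\<close>.
\<close>

lemma norm_complex_cond_exp_le:
  assumes f: "f \<in> cond_exp_domain M F"
  shows "AE x in M. ennreal (cmod (complex_cond_exp M F f x))
    \<le> nn_cond_exp M F (\<lambda>y. ennreal (cmod (f y))) x"
proof -
  note fM [measurable] = cond_exp_domain_measurable[OF f]
  define a where "a x = sgn (cnj (complex_cond_exp M F f x))" for x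
  have a [measurable]: "a \<in> borel_measurable F" unfolding a_def sgn_div_norm by measurable
  note [measurable] = measurable_from_subalg[OF subalg a]
  have "AE x in M. complex_cond_exp M F (\<lambda>y. a y * f y) x = a x * complex_cond_exp M F f x"
    by (rule complex_cond_exp_mult[OF a f])
  moreover have "AE x in M. ennreal \<bar>real_cond_exp M F (\<lambda>y. Re (a y * f y)) x\<bar>
      \<le> nn_cond_exp M F (\<lambda>y. ennreal \<bar>Re (a y * f y)\<bar>) x"
    by (rule real_cond_exp_abs) measurable
  moreover have "AE x in M. nn_cond_exp M F (\<lambda>y. ennreal \<bar>Re (a y * f y)\<bar>) x
      \<le> nn_cond_exp M F (\<lambda>y. ennreal (cmod (f y))) x"
  proof (rule nn_cond_exp_mono)
    have "\<bar>Re (a y * f y)\<bar> \<le> cmod (f y)" for y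
    proof -
      have "\<bar>Re (a y * f y)\<bar> \<le> cmod (a y) * cmod (f y)"
        using abs_Re_le_cmod[of "a y * f y"] by (simp add: norm_mult)
      also have "\<dots> \<le> 1 * cmod (f y)"
        by (intro mult_right_mono) (auto simp: a_def norm_sgn)
      finally show ?thesis by simp
    qed
    then show "AE y in M. ennreal \<bar>Re (a y * f y)\<bar> \<le> ennreal (cmod (f y))"
      by (intro AE_I2 ennreal_leI)
  qed measurable
  ultimately show ?thesis
  proof eventually_elim
    case (elim x)
    let ?e = "complex_cond_exp M F f x"
    have "a x * ?e = complex_of_real ((cmod ?e)\<^sup>2) / complex_of_real (cmod ?e)"
      unfolding complex_norm_square a_def sgn_eq by (simp add: mult.commute)
    also have "\<dots> = complex_of_real (cmod ?e)"
      by (cases "?e = 0") (simp_all add: power2_eq_square)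
    finally have "a x * ?e = complex_of_real (cmod ?e)" .
    then have "real_cond_exp M F (\<lambda>y. Re (a y * f y)) x = cmod ?e"
      using elim(1) unfolding Re_complex_cond_exp[symmetric] by simp
    then show ?case using elim(2,3) by simp
  qed
qed

end

section \<open>The conditional Cauchy--Schwarz inequality\<close>

text \<open>
  The discriminant of a nonnegative quadratic polynomial is not positive; the witnesses are its
  minimum \<open>s = c / a\<close> and, in the degenerate case \<open>a = 0\<close>, a point where the linear function \<open>2 s c\<close>
  exceeds \<open>b\<close>.
\<close>

lemma square_le_mult_if_quadratic_nonneg:
  fixes a b c :: real
  assumes quad: "\<And>s. 2 * s * c \<le> s\<^sup>2 * a + b" and "a \<ge> 0"
  shows "c\<^sup>2 \<le> a * b"
proof (cases "a = 0")
  case True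
  have "c = 0"
  proof (rule ccontr)
    assume "c \<noteq> 0"
    then have "2 * ((b + 1) / (2 * c)) * c = b + 1" by simp
    then show False using quad[of "(b + 1) / (2 * c)"] True by simp
  qed
  then show ?thesis using True by simp
next
  case False
  then show ?thesis using quad[of "c / a"] \<open>a \<ge> 0\<close> 
    by (simp add: field_simps power2_eq_square)
qed

context sigma_finite_subalgebra
begin

lemma borel_measurable_cond_exp_sq [measurable]:
  "cond_exp_sq M F f \<in> borel_measurable F" "cond_exp_sq M F f \<in> borel_measurable M"
  by (simp_all add: cond_exp_sq_def)

text \<open>
  Conditioning \<open>2 r |f g| \<le> r\<^sup>2 |f|\<^sup>2 + |g|\<^sup>2\<close> gives a null set for each \<open>r\<close>. Only rational \<open>r\<close> are used,
  so that the exceptional sets stay null in total; density then yields the inequality for all real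
  \<open>r\<close> at almost every point, and the discriminant gives the claim.
\<close>

lemma nn_cond_exp_mult_square_le:
  assumes [measurable]: "f \<in> borel_measurable M" "g \<in> borel_measurable M"
    and f_fin: "AE x in M. cond_exp_sq M F f x < \<infinity>"
    and g_fin: "AE x in M. cond_exp_sq M F g x < \<infinity>"
  shows "AE x in M. (nn_cond_exp M F (\<lambda>y. ennreal (cmod (f y * g y))) x)\<^sup>2
    \<le> cond_exp_sq M F f x * cond_exp_sq M F g x"
proof -
  let ?C = "nn_cond_exp M F (\<lambda>y. ennreal (cmod (f y * g y)))"
  have young: "AE x in M. ennreal (2 * \<bar>of_rat q\<bar>) * ?C x
      \<le> ennreal ((of_rat q)\<^sup>2) * cond_exp_sq M F f x + cond_exp_sq M F g x" for q :: rat
  proof -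
    define r where "r = \<bar>real_of_rat q\<bar>"
    have "AE x in M. ennreal (2 * r) * ?C x
        = nn_cond_exp M F (\<lambda>y. ennreal (2 * r) * ennreal (cmod (f y * g y))) x"
      by (rule nn_cond_exp_prod) measurable
    moreover have "AE x in M. nn_cond_exp M F (\<lambda>y. ennreal (2 * r) * ennreal (cmod (f y * g y))) x
       \<le> nn_cond_exp M F (\<lambda>y. ennreal (r\<^sup>2) * ennreal ((cmod (f y))\<^sup>2) + ennreal ((cmod (g y))\<^sup>2)) x"
    proof (rule nn_cond_exp_mono)
      have "2 * r * cmod (f y * g y) \<le> r\<^sup>2 * (cmod (f y))\<^sup>2 + (cmod (g y))\<^sup>2" for y
        using sum_squares_bound[of "r * cmod (f y)" "cmod (g y)"]
        by (simp add: norm_mult power_mult_distrib mult.assoc)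
      then show "AE y in M. ennreal (2 * r) * ennreal (cmod (f y * g y))
          \<le> ennreal (r\<^sup>2) * ennreal ((cmod (f y))\<^sup>2) + ennreal ((cmod (g y))\<^sup>2)"
        by (intro AE_I2) (simp add: ennreal_mult[symmetric] ennreal_plus[symmetric] r_def ennreal_leI
          del: ennreal_plus)
    qed measurable
    moreover have "AE x in M. nn_cond_exp M F (\<lambda>y. ennreal (r\<^sup>2) * ennreal ((cmod (f y))\<^sup>2)) x
          + nn_cond_exp M F (\<lambda>y. ennreal ((cmod (g y))\<^sup>2)) x
        = nn_cond_exp M F (\<lambda>y. ennreal (r\<^sup>2) * ennreal ((cmod (f y))\<^sup>2) + ennreal ((cmod (g y))\<^sup>2)) x"
      by (rule nn_cond_exp_sum) measurable
    moreover have "AE x in M. ennreal (r\<^sup>2) * nn_cond_exp M F (\<lambda>y. ennreal ((cmod (f y))\<^sup>2)) x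
        = nn_cond_exp M F (\<lambda>y. ennreal (r\<^sup>2) * ennreal ((cmod (f y))\<^sup>2)) x"
      by (rule nn_cond_exp_prod) measurable
    ultimately show ?thesis
    proof eventually_elim
      case (elim x)
      have "\<bar>real_of_rat q\<bar> = r" "(real_of_rat q)\<^sup>2 = r\<^sup>2" by (simp_all only: r_def power2_abs)
      then show ?case using elim by (simp add: cond_exp_sq_def)
    qed
  qed
  then have "AE x in M. \<forall>q. ennreal (2 * \<bar>of_rat q\<bar>) * ?C x
      \<le> ennreal ((of_rat q)\<^sup>2) * cond_exp_sq M F f x + cond_exp_sq M F g x"
    by (simp add: AE_all_countable)
  then show ?thesis using f_fin g_fin
  proof eventually_elim
    case (elim x)
    obtain a where a: "cond_exp_sq M F f x = ennreal a" "a \<ge> 0"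
      using elim(2) by (cases "cond_exp_sq M F f x") auto
    obtain b where b: "cond_exp_sq M F g x = ennreal b" "b \<ge> 0"
      using elim(3) by (cases "cond_exp_sq M F g x") auto
    \<comment> \<open>The case \<open>r = 1\<close> shows that \<open>E(|f g|)\<close> is finite, so that real arithmetic applies.\<close>
    have "ennreal 2 * ?C x \<le> ennreal (a + b)"
      using elim(1)[rule_format, of 1] a b by simp
    then have "?C x < \<infinity>"
      by (auto simp: less_top[symmetric] ennreal_mult_eq_top_iff top_unique)
    then obtain c where c: "?C x = ennreal c" "c \<ge> 0"
      by (cases "?C x") auto
    have rat: "2 * \<bar>of_rat q\<bar> * c \<le> (of_rat q)\<^sup>2 * a + b" for q
      using elim(1)[rule_format, of q] a b c
      by (simp add: ennreal_mult[symmetric] ennreal_plus[symmetric] del: ennreal_plus)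
    have "closed {s::real. 2 * \<bar>s\<bar> * c \<le> s\<^sup>2 * a + b}"
      by (intro closed_Collect_le continuous_intros)
    moreover have "\<rat> \<subseteq> {s::real. 2 * \<bar>s\<bar> * c \<le> s\<^sup>2 * a + b}"
      using rat by (auto simp: Rats_def)
    ultimately have "UNIV \<subseteq> {s::real. 2 * \<bar>s\<bar> * c \<le> s\<^sup>2 * a + b}"
      unfolding Rats_closure_real[symmetric] by (rule closure_minimal[rotated])
    then have "2 * \<bar>s\<bar> * c \<le> s\<^sup>2 * a + b" for s :: real by auto
    moreover have "2 * s * c \<le> 2 * \<bar>s\<bar> * c" for s :: real
      using c(2) by (intro mult_right_mono) auto
    ultimately have "2 * s * c \<le> s\<^sup>2 * a + b" for s :: real by (meson order_trans)
    then have "c\<^sup>2 \<le> a * b"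
      using a(2) by (rule square_le_mult_if_quadratic_nonneg)
    then show ?case using a b c
      by (simp add: ennreal_mult[symmetric] ennreal_power ennreal_leI)
  qed
qed

lemma cond_exp_domain_mult_square:
  assumes [measurable]: "f \<in> borel_measurable M" "g \<in> borel_measurable M"
    and f_fin: "AE x in M. cond_exp_sq M F f x < \<infinity>"
    and g_fin: "AE x in M. cond_exp_sq M F g x < \<infinity>"
  shows "(\<lambda>x. f x * g x) \<in> cond_exp_domain M F"
proof -
  have "AE x in M. nn_cond_exp M F (\<lambda>y. ennreal (cmod (f y * g y))) x < \<infinity>"
    using nn_cond_exp_mult_square_le[OF assms] f_fin g_fin
  proof eventually_elim
    case (elim x)
    then have "(nn_cond_exp M F (\<lambda>y. ennreal (cmod (f y * g y))) x)\<^sup>2 < \<infinity>"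
      by (auto intro: le_less_trans simp: ennreal_mult_less_top)
    then show ?case by (simp add: power2_eq_square ennreal_mult_less_top less_top[symmetric] ennreal_mult_eq_top_iff)
  qed
  then show ?thesis by (simp add: cond_exp_domain_def)
qed

lemma norm_complex_cond_exp_mult_square_le:
  assumes [measurable]: "f \<in> borel_measurable M" "g \<in> borel_measurable M"
    and f_fin: "AE x in M. cond_exp_sq M F f x < \<infinity>"
    and g_fin: "AE x in M. cond_exp_sq M F g x < \<infinity>"
  shows "AE x in M. ennreal ((cmod (complex_cond_exp M F (\<lambda>y. f y * g y) x))\<^sup>2)
    \<le> cond_exp_sq M F f x * cond_exp_sq M F g x"
  using nn_cond_exp_mult_square_le[OF assms]
    norm_complex_cond_exp_le[OF cond_exp_domain_mult_square[OF assms]]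
proof eventually_elim
  case (elim x)
  have "ennreal ((cmod (complex_cond_exp M F (\<lambda>y. f y * g y) x))\<^sup>2)
      = (ennreal (cmod (complex_cond_exp M F (\<lambda>y. f y * g y) x)))\<^sup>2"
    by (simp add: ennreal_power)
  also have "\<dots> \<le> (nn_cond_exp M F (\<lambda>y. ennreal (cmod (f y * g y))) x)\<^sup>2"
    using elim(2) by (intro power_mono) auto
  finally show ?case using elim(1) by order
qed

end

section \<open>Square integrable functions\<close>

lemma L2_measurable: "f \<in> L2 M \<Longrightarrow> f \<in> borel_measurable M"
  by (simp add: L2_def)

lemma L2_cnj: "f \<in> L2 M \<Longrightarrow> (\<lambda>x. cnj (f x)) \<in> L2 M"
  by (simp add: L2_def borel_measurable_cnj)

lemma nn_integral_L2:
  assumes "f \<in> L2 M"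
  shows "(\<integral>\<^sup>+x. ennreal ((cmod (f x))\<^sup>2) \<partial>M) = ennreal ((L2_norm M f)\<^sup>2)"
  using assms by (simp add: L2_def L2_norm_def nn_integral_eq_integral)

lemma L2_if_nn_integral_finite:
  assumes [measurable]: "f \<in> borel_measurable M"
    and "(\<integral>\<^sup>+x. ennreal ((cmod (f x))\<^sup>2) \<partial>M) < \<infinity>"
  shows "f \<in> L2 M"
  using assms(2) by (simp add: L2_def integrable_iff_bounded)

lemma integrable_mult_L2:
  assumes f: "f \<in> L2 M" and g: "g \<in> L2 M"
  shows "integrable M (\<lambda>x. f x * g x)"
proof (rule Bochner_Integration.integrable_bound)
  note [measurable] = L2_measurable[OF f] L2_measurable[OF g]
  show "integrable M (\<lambda>x. (cmod (f x))\<^sup>2 + (cmod (g x))\<^sup>2)"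
    using f g by (simp add: L2_def)
  show "(\<lambda>x. f x * g x) \<in> borel_measurable M" by measurable
  have "cmod (f x * g x) \<le> (cmod (f x))\<^sup>2 + (cmod (g x))\<^sup>2" for x
  proof -
    have "0 \<le> cmod (f x) * cmod (g x)" by simp
    then show ?thesis
      using sum_squares_bound[of "cmod (f x)" "cmod (g x)"] unfolding norm_mult by linarith
  qed
  then show "AE x in M. norm (f x * g x) \<le> norm ((cmod (f x))\<^sup>2 + (cmod (g x))\<^sup>2)"
    by simp
qed

lemma L2_diff:
  assumes f: "f \<in> L2 M" and g: "g \<in> L2 M"
  shows "(\<lambda>x. f x - g x) \<in> L2 M"
proof -
  note [measurable] = L2_measurable[OF f] L2_measurable[OF g]
  have "integrable M (\<lambda>x. (cmod (f x - g x))\<^sup>2)"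
  proof (rule Bochner_Integration.integrable_bound)
    show "integrable M (\<lambda>x. 2 * (cmod (f x))\<^sup>2 + 2 * (cmod (g x))\<^sup>2)"
      using f g by (simp add: L2_def)
    show "AE x in M. norm ((cmod (f x - g x))\<^sup>2) \<le> norm (2 * (cmod (f x))\<^sup>2 + 2 * (cmod (g x))\<^sup>2)"
    proof (intro AE_I2)
      fix x
      have "(cmod (f x - g x))\<^sup>2 \<le> (cmod (f x) + cmod (g x))\<^sup>2"
        by (intro power_mono norm_triangle_ineq4) simp
      also have "\<dots> \<le> 2 * (cmod (f x))\<^sup>2 + 2 * (cmod (g x))\<^sup>2"
        using sum_squares_bound[of "cmod (f x)" "cmod (g x)"] by (simp add: power2_sum)
      finally show "norm ((cmod (f x - g x))\<^sup>2) \<le> norm (2 * (cmod (f x))\<^sup>2 + 2 * (cmod (g x))\<^sup>2)"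
        by simp
    qed
  qed measurable
  then show ?thesis by (simp add: L2_def)
qed

text \<open>
  This makes adjoints unique up to null sets. Test with \<open>f = g - h\<close>.
\<close>

lemma AE_eq_if_L2_inner_eq:
  assumes g: "g \<in> L2 M" and h: "h \<in> L2 M"
    and eq: "\<And>f. f \<in> L2 M \<Longrightarrow> L2_inner M f g = L2_inner M f h"
  shows "AE x in M. g x = h x"
proof -
  define d where "d x = g x - h x" for x
  have d: "d \<in> L2 M" unfolding d_def by (rule L2_diff[OF g h])
  have "complex_of_real (LINT x|M. (cmod (d x))\<^sup>2) = (LINT x|M. d x * cnj (g x) - d x * cnj (h x))"
    unfolding integral_complex_of_real[symmetric] complex_norm_square
    by (intro Bochner_Integration.integral_cong) (simp_all add: d_def algebra_simps)
  also have "\<dots> = L2_inner M d g - L2_inner M d h"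
    unfolding L2_inner_def using d g h
    by (intro Bochner_Integration.integral_diff integrable_mult_L2 L2_cnj)
  also have "\<dots> = 0" using eq[OF d] by simp
  finally have "(LINT x|M. (cmod (d x))\<^sup>2) = 0" by simp
  then have "AE x in M. (cmod (d x))\<^sup>2 = 0"
    using d by (subst (asm) integral_nonneg_eq_0_iff_AE) (auto simp: L2_def)
  then show ?thesis by eventually_elim (simp add: d_def)
qed

context sigma_finite_subalgebra
begin

lemma cond_exp_sq_L2_finite:
  assumes "f \<in> L2 M"
  shows "AE x in M. cond_exp_sq M F f x < \<infinity>"
proof -
  have [measurable]: "f \<in> borel_measurable M" using assms by (rule L2_measurable)
  show ?thesis
    unfolding cond_exp_sq_def
    by (rule nn_cond_exp_finite) (simp_all add: nn_integral_L2[OF assms])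
qed

lemma cond_exp_sq_cnj: "cond_exp_sq M F (\<lambda>x. cnj (f x)) = cond_exp_sq M F f"
  by (simp add: cond_exp_sq_def)

lemma weighted_cond_exp_cong:
  assumes eq: "AE x in M. f x = g x"
    and [measurable]: "f \<in> borel_measurable M" "g \<in> borel_measurable M" "u \<in> borel_measurable M"
  shows "AE x in M. weighted_cond_exp M F w u f x = weighted_cond_exp M F w u g x"
proof -
  have "AE x in M. complex_cond_exp M F (\<lambda>y. u y * f y) x = complex_cond_exp M F (\<lambda>y. u y * g y) x"
    by (rule complex_cond_exp_cong) (use eq in \<open>auto elim: eventually_mono\<close>)
  then show ?thesis by eventually_elim (simp add: weighted_cond_exp_def)
qed

lemma nn_integral_cond_exp_sq_mult:
  assumes [measurable]: "e \<in> borel_measurable F" "w \<in> borel_measurable M"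
  shows "(\<integral>\<^sup>+x. ennreal ((cmod (w x * e x))\<^sup>2) \<partial>M)
    = (\<integral>\<^sup>+x. ennreal ((cmod (e x))\<^sup>2) * cond_exp_sq M F w x \<partial>M)"
proof -
  have "(\<integral>\<^sup>+x. ennreal ((cmod (w x * e x))\<^sup>2) \<partial>M)
      = (\<integral>\<^sup>+x. ennreal ((cmod (e x))\<^sup>2) * ennreal ((cmod (w x))\<^sup>2) \<partial>M)"
    by (simp add: norm_mult power_mult_distrib ennreal_mult mult.commute)
  also have "\<dots> = (\<integral>\<^sup>+x. ennreal ((cmod (e x))\<^sup>2) * cond_exp_sq M F w x \<partial>M)"
    unfolding cond_exp_sq_def by (rule nn_cond_exp_intg[symmetric]) measurable
  finally show ?thesis .
qed

end

section \<open>Normality when the second moments are finite\<close>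

text \<open>
  These assumptions are preserved by passing to the adjoint, which replaces the weights \<open>(u, w)\<close> by
  \<open>(cnj w, cnj u)\<close>. Everything proved for \<open>f \<mapsto> w E(u f)\<close> in this locale is therefore available for
  the adjoint \<open>f \<mapsto> cnj u E(cnj w f)\<close> as well.
\<close>

locale square_bounded_weights = sigma_finite_subalgebra M F for M F :: "'a measure" +
  fixes u w :: "'a \<Rightarrow> complex" and K :: real
  assumes u_measurable [measurable]: "u \<in> borel_measurable M"
    and w_measurable [measurable]: "w \<in> borel_measurable M"
    and u_finite: "AE x in M. cond_exp_sq M F u x < \<infinity>"
    and w_finite: "AE x in M. cond_exp_sq M F w x < \<infinity>"
    and K_nonneg: "K \<ge> 0"
    and sq_bound: "AE x in M. cond_exp_sq M F u x * cond_exp_sq M F w x \<le> ennreal K"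
begin

lemma adjoint_weights: "square_bounded_weights M F (\<lambda>x. cnj (w x)) (\<lambda>x. cnj (u x)) K"
  by unfold_locales
    (use u_finite w_finite K_nonneg sq_bound in \<open>auto simp: cond_exp_sq_cnj mult.commute\<close>)

lemma mult_L2_domain:
  assumes f: "f \<in> L2 M"
  shows "(\<lambda>x. u x * f x) \<in> cond_exp_domain M F"
  using cond_exp_domain_mult_square[OF u_measurable L2_measurable[OF f] u_finite cond_exp_sq_L2_finite[OF f]] .

lemma weighted_cond_exp_measurable [measurable]:
  "weighted_cond_exp M F w u f \<in> borel_measurable M"
  unfolding weighted_cond_exp_def[abs_def] by measurable

text \<open>
  As \<open>E(u f)\<close> is \<open>F\<close>-measurable, \<open>|w|\<^sup>2\<close> may be replaced by \<open>W\<close> under the integral of \<open>|w E(u f)|\<^sup>2\<close>; by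
  conditional Cauchy--Schwarz the new integrand is at most \<open>W U E(|f|\<^sup>2) \<le> K E(|f|\<^sup>2)\<close>.
\<close>

lemma nn_integral_weighted_cond_exp_le:
  assumes f: "f \<in> L2 M"
  shows "(\<integral>\<^sup>+x. ennreal ((cmod (weighted_cond_exp M F w u f x))\<^sup>2) \<partial>M)
    \<le> ennreal K * (\<integral>\<^sup>+x. ennreal ((cmod (f x))\<^sup>2) \<partial>M)"
proof -
  note [measurable] = L2_measurable[OF f]
  let ?e = "complex_cond_exp M F (\<lambda>y. u y * f y)"
  have "(\<integral>\<^sup>+x. ennreal ((cmod (weighted_cond_exp M F w u f x))\<^sup>2) \<partial>M)
      = (\<integral>\<^sup>+x. ennreal ((cmod (?e x))\<^sup>2) * cond_exp_sq M F w x \<partial>M)"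
    unfolding weighted_cond_exp_def by (rule nn_integral_cond_exp_sq_mult) measurable
  also have "\<dots> \<le> (\<integral>\<^sup>+x. ennreal K * cond_exp_sq M F f x \<partial>M)"
  proof (rule nn_integral_mono_AE)
    show "AE x in M. ennreal ((cmod (?e x))\<^sup>2) * cond_exp_sq M F w x \<le> ennreal K * cond_exp_sq M F f x"
      using norm_complex_cond_exp_mult_square_le[OF u_measurable L2_measurable[OF f] u_finite
          cond_exp_sq_L2_finite[OF f]] sq_bound
    proof eventually_elim
      case (elim x)
      have "ennreal ((cmod (?e x))\<^sup>2) * cond_exp_sq M F w x
          \<le> (cond_exp_sq M F u x * cond_exp_sq M F f x) * cond_exp_sq M F w x"
        using elim(1) by (rule mult_right_mono) simp
      also have "\<dots> = (cond_exp_sq M F u x * cond_exp_sq M F w x) * cond_exp_sq M F f x"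
        by (simp add: mult_ac)
      also have "\<dots> \<le> ennreal K * cond_exp_sq M F f x"
        using elim(2) by (rule mult_right_mono) simp
      finally show ?case .
    qed
  qed
  also have "\<dots> = (\<integral>\<^sup>+x. ennreal K * ennreal ((cmod (f x))\<^sup>2) \<partial>M)"
    unfolding cond_exp_sq_def by (rule nn_cond_exp_intg) measurable
  also have "\<dots> = ennreal K * (\<integral>\<^sup>+x. ennreal ((cmod (f x))\<^sup>2) \<partial>M)"
    by (rule nn_integral_cmult) measurable
  finally show ?thesis .
qed

lemma weighted_cond_exp_L2:
  assumes f: "f \<in> L2 M"
  shows "weighted_cond_exp M F w u f \<in> L2 M"
proof (rule L2_if_nn_integral_finite[OF weighted_cond_exp_measurable])
  have "ennreal K * (\<integral>\<^sup>+x. ennreal ((cmod (f x))\<^sup>2) \<partial>M) < \<infinity>"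
    by (simp add: nn_integral_L2[OF f] ennreal_mult_less_top)
  then show "(\<integral>\<^sup>+x. ennreal ((cmod (weighted_cond_exp M F w u f x))\<^sup>2) \<partial>M) < \<infinity>"
    using nn_integral_weighted_cond_exp_le[OF f] by (rule le_less_trans[rotated])
qed

lemma bounded_weighted_cond_exp: "bounded_L2_operator M (weighted_cond_exp M F w u)"
  unfolding bounded_L2_operator_def
proof (intro conjI ballI allI)
  fix f g and c :: complex
  assume f: "f \<in> L2 M"
  show "weighted_cond_exp M F w u f \<in> L2 M" by (rule weighted_cond_exp_L2[OF f])
  show "AE x in M. weighted_cond_exp M F w u (\<lambda>y. c * f y) x = c * weighted_cond_exp M F w u f x"
    using complex_cond_exp_mult[OF borel_measurable_const mult_L2_domain[OF f], of c]
    by eventually_elim (simp add: weighted_cond_exp_def mult_ac)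
  assume g: "g \<in> L2 M"
  show "AE x in M. weighted_cond_exp M F w u (\<lambda>y. f y + g y) x
      = weighted_cond_exp M F w u f x + weighted_cond_exp M F w u g x"
    using complex_cond_exp_add[OF mult_L2_domain[OF f] mult_L2_domain[OF g]]
    by eventually_elim (simp add: weighted_cond_exp_def distrib_left)
next
  show "\<exists>C. \<forall>f\<in>L2 M. L2_norm M (weighted_cond_exp M F w u f) \<le> C * L2_norm M f"
  proof (intro exI[of _ "sqrt K"] ballI)
    fix f assume f: "f \<in> L2 M"
    have nonneg: "0 \<le> L2_norm M g" for g
      by (simp add: L2_norm_def integral_nonneg_AE)
    have "(L2_norm M (weighted_cond_exp M F w u f))\<^sup>2 \<le> K * (L2_norm M f)\<^sup>2"
      using nn_integral_weighted_cond_exp_le[OF f] K_nonneg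
      by (simp add: nn_integral_L2[OF f] nn_integral_L2[OF weighted_cond_exp_L2[OF f]]
          ennreal_mult[symmetric])
    then have "(L2_norm M (weighted_cond_exp M F w u f))\<^sup>2 \<le> (sqrt K * L2_norm M f)\<^sup>2"
      using K_nonneg by (simp add: power_mult_distrib)
    then show "L2_norm M (weighted_cond_exp M F w u f) \<le> sqrt K * L2_norm M f"
      by (rule power2_le_imp_le) (simp add: K_nonneg nonneg)
  qed
qed

text \<open>
  Both inner products equal the integral of \<open>E(u f) E(w cnj g)\<close>: on either side, replace the
  integrand by its conditional expectation and pull out the factor that is already
  \<open>F\<close>-measurable.
\<close>

lemma L2_inner_adjoint:
  assumes f: "f \<in> L2 M" and g: "g \<in> L2 M"
  shows "L2_inner M (weighted_cond_exp M F w u f) g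
    = L2_inner M f (weighted_cond_exp M F (\<lambda>x. cnj (u x)) (\<lambda>x. cnj (w x)) g)"
proof -
  interpret adj: square_bounded_weights M F "\<lambda>x. cnj (w x)" "\<lambda>x. cnj (u x)" K
    by (rule adjoint_weights)
  let ?e = "complex_cond_exp M F (\<lambda>y. u y * f y)"
  let ?d = "complex_cond_exp M F (\<lambda>y. w y * cnj (g y))"
  note [measurable] = L2_measurable[OF f] L2_measurable[OF g]
  have d: "?d x = cnj (complex_cond_exp M F (\<lambda>y. cnj (w y) * g y) x)" for x
    unfolding complex_cond_exp_cnj[symmetric] by simp
  have wg: "(\<lambda>y. w y * cnj (g y)) \<in> cond_exp_domain M F"
    by (rule cond_exp_domain_mono[OF adj.mult_L2_domain[OF g]]) (auto simp: norm_mult)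
  have int1: "integrable M (\<lambda>x. ?e x * (w x * cnj (g x)))"
    using integrable_mult_L2[OF weighted_cond_exp_L2[OF f] L2_cnj[OF g]]
    by (simp add: weighted_cond_exp_def mult_ac)
  have int2: "integrable M (\<lambda>x. ?d x * (u x * f x))"
    using integrable_mult_L2[OF f L2_cnj[OF adj.weighted_cond_exp_L2[OF g]]]
    by (simp add: weighted_cond_exp_def d mult_ac)
  have "L2_inner M (weighted_cond_exp M F w u f) g = (LINT x|M. ?e x * (w x * cnj (g x)))"
    by (simp add: L2_inner_def weighted_cond_exp_def mult_ac)
  also have "\<dots> = (LINT x|M. complex_cond_exp M F (\<lambda>x. ?e x * (w x * cnj (g x))) x)"
    by (rule integral_complex_cond_exp[OF int1, symmetric])
  also have "\<dots> = (LINT x|M. ?e x * ?d x)"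
    using complex_cond_exp_mult[OF borel_measurable_complex_cond_exp wg]
    by (intro integral_cong_AE) auto
  also have "\<dots> = (LINT x|M. ?d x * ?e x)"
    by (simp add: mult.commute)
  also have "\<dots> = (LINT x|M. complex_cond_exp M F (\<lambda>x. ?d x * (u x * f x)) x)"
    using AE_symmetric[OF complex_cond_exp_mult[OF borel_measurable_complex_cond_exp mult_L2_domain[OF f]]]
    by (intro integral_cong_AE) auto
  also have "\<dots> = (LINT x|M. ?d x * (u x * f x))"
    by (rule integral_complex_cond_exp[OF int2])
  also have "\<dots> = L2_inner M f (weighted_cond_exp M F (\<lambda>x. cnj (u x)) (\<lambda>x. cnj (w x)) g)"
    by (simp add: L2_inner_def weighted_cond_exp_def d mult_ac)
  finally show ?thesis .
qed

lemma of_real_cond_exp_sq: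
  "AE x in M. complex_cond_exp M F (\<lambda>y. complex_of_real ((cmod (u y))\<^sup>2)) x
    = complex_of_real (enn2real (cond_exp_sq M F u x))"
  unfolding cond_exp_sq_def by (rule complex_cond_exp_of_nonneg) auto

text \<open>
  The inner function contributes \<open>u cnj u = |u|\<^sup>2\<close> times an \<open>F\<close>-measurable factor to the outer
  conditional expectation. For the adjoint pair of weights this lemma computes the composition in
  the other order.
\<close>

lemma weighted_cond_exp_adjoint_comp:
  "AE x in M. weighted_cond_exp M F w u (weighted_cond_exp M F (\<lambda>x. cnj (u x)) (\<lambda>x. cnj (w x)) f) x
    = w x * complex_of_real (enn2real (cond_exp_sq M F u x))
      * complex_cond_exp M F (\<lambda>y. cnj (w y) * f y) x"
proof -
  let ?e = "complex_cond_exp M F (\<lambda>y. cnj (w y) * f y)"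
  have sq: "(\<lambda>y. complex_of_real ((cmod (u y))\<^sup>2)) \<in> cond_exp_domain M F"
    using u_finite by (simp add: cond_exp_domain_def cond_exp_sq_def norm_power)
  have arg: "(\<lambda>y. u y * weighted_cond_exp M F (\<lambda>x. cnj (u x)) (\<lambda>x. cnj (w x)) f y)
      = (\<lambda>y. ?e y * complex_of_real ((cmod (u y))\<^sup>2))"
    unfolding complex_norm_square weighted_cond_exp_def by (simp add: mult_ac)
  have "AE x in M. complex_cond_exp M F (\<lambda>y. ?e y * complex_of_real ((cmod (u y))\<^sup>2)) x
      = ?e x * complex_cond_exp M F (\<lambda>y. complex_of_real ((cmod (u y))\<^sup>2)) x"
    by (rule complex_cond_exp_mult[OF _ sq]) measurable
  then show ?thesis using of_real_cond_exp_sq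
    unfolding weighted_cond_exp_def[of _ _ w u] arg by eventually_elim (simp add: mult_ac)
qed

text \<open>
  The operator \<open>T\<close> is only required to agree almost everywhere with \<open>f \<mapsto> w E(u f)\<close>, because the
  lemma is later applied to an operator given by other weights. Any adjoint of \<open>T\<close> agrees almost
  everywhere with the explicit one, so both compositions are known.
\<close>

lemma normal_iff:
  assumes T: "bounded_L2_operator M T"
    and T_eq: "\<And>f. f \<in> L2 M \<Longrightarrow> AE x in M. T f x = weighted_cond_exp M F w u f x"
  shows "normal_L2_operator M T \<longleftrightarrow>
    (\<forall>f\<in>L2 M. AE x in M.
      w x * complex_of_real (enn2real (cond_exp_sq M F u x)) * complex_cond_exp M F (\<lambda>y. cnj (w y) * f y) x
      = cnj (u x) * complex_of_real (enn2real (cond_exp_sq M F w x)) * complex_cond_exp M F (\<lambda>y. u y * f y) x)"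
    (is "_ \<longleftrightarrow> ?R")
proof -
  interpret adj: square_bounded_weights M F "\<lambda>x. cnj (w x)" "\<lambda>x. cnj (u x)" K
    by (rule adjoint_weights)
  let ?T = "weighted_cond_exp M F w u"
  let ?S = "weighted_cond_exp M F (\<lambda>x. cnj (u x)) (\<lambda>x. cnj (w x))"
  have T_L2: "T f \<in> L2 M" if "f \<in> L2 M" for f
    using T that by (simp add: bounded_L2_operator_def)
  have inner: "L2_inner M (T f) g = L2_inner M f (?S g)" if f: "f \<in> L2 M" and g: "g \<in> L2 M" for f g
  proof -
    note [measurable] = L2_measurable[OF g] L2_measurable[OF T_L2[OF f]]
    have "L2_inner M (T f) g = L2_inner M (?T f) g"
      unfolding L2_inner_def using T_eq[OF f] by (intro integral_cong_AE) auto
    then show ?thesis using L2_inner_adjoint[OF f g] by simp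
  qed
  have ST: "AE x in M. ?S (T f) x = cnj (u x) * complex_of_real (enn2real (cond_exp_sq M F w x))
      * complex_cond_exp M F (\<lambda>y. u y * f y) x" if f: "f \<in> L2 M" for f
  proof -
    note [measurable] = L2_measurable[OF T_L2[OF f]]
    have "AE x in M. ?S (T f) x = ?S (?T f) x"
      by (rule weighted_cond_exp_cong[OF T_eq[OF f]]) measurable
    then show ?thesis using adj.weighted_cond_exp_adjoint_comp[of f]
      by eventually_elim (simp add: cond_exp_sq_cnj)
  qed
  have TS: "AE x in M. T g x = w x * complex_of_real (enn2real (cond_exp_sq M F u x))
      * complex_cond_exp M F (\<lambda>y. cnj (w y) * f y) x"
    if f: "f \<in> L2 M" and g: "g \<in> L2 M" "AE x in M. g x = ?S f x" for f g
  proof -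
    note [measurable] = L2_measurable[OF g(1)] 
    have "AE x in M. ?T g x = ?T (?S f) x"
      by (rule weighted_cond_exp_cong[OF g(2)]) measurable
    then show ?thesis using T_eq[OF g(1)] weighted_cond_exp_adjoint_comp[of f]
      by eventually_elim simp
  qed
  show ?thesis
  proof
    assume "normal_L2_operator M T"
    then obtain S where S: "is_L2_adjoint M T S"
        and comm: "\<And>f. f \<in> L2 M \<Longrightarrow> AE x in M. S (T f) x = T (S f) x"
      unfolding normal_L2_operator_def by blast
    have S_L2: "S g \<in> L2 M" if "g \<in> L2 M" for g
      using S that by (simp add: is_L2_adjoint_def bounded_L2_operator_def)
    have S_eq: "AE x in M. S g x = ?S g x" if g: "g \<in> L2 M" for g
      using S inner g
      by (intro AE_eq_if_L2_inner_eq[OF S_L2[OF g] adj.weighted_cond_exp_L2[OF g]])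
        (simp add: is_L2_adjoint_def)
    show ?R
    proof
      fix f assume f: "f \<in> L2 M"
      show "AE x in M. w x * complex_of_real (enn2real (cond_exp_sq M F u x)) * complex_cond_exp M F (\<lambda>y. cnj (w y) * f y) x
        = cnj (u x) * complex_of_real (enn2real (cond_exp_sq M F w x)) * complex_cond_exp M F (\<lambda>y. u y * f y) x"
        using comm[OF f] S_eq[OF T_L2[OF f]] ST[OF f] TS[OF f S_L2[OF f] S_eq[OF f]]
        by eventually_elim simp
    qed
  next
    assume R: ?R
    have "is_L2_adjoint M T ?S"
      unfolding is_L2_adjoint_def using adj.bounded_weighted_cond_exp inner by blast
    moreover have "AE x in M. ?S (T f) x = T (?S f) x" if f: "f \<in> L2 M" for f
      using R[rule_format, OF f] ST[OF f] TS[OF f adj.weighted_cond_exp_L2[OF f] AE_I2[OF refl]]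
      by eventually_elim simp
    ultimately show "normal_L2_operator M T"
      unfolding normal_L2_operator_def using T by blast
  qed
qed

text \<open>
  With \<open>a = \<surd>U\<close> and \<open>b = \<surd>W\<close>: \<open>w a\<^sup>2 E(cnj w f) = (a w) E(a cnj w f) = (b cnj u) E(b u f)
  = cnj u b\<^sup>2 E(u f)\<close>.
\<close>

lemma normal_relation_if_proportional:
  assumes eq: "AE x in M. complex_of_real (cond_exp_sq_root M F u x) * cnj (w x)
      = u x * complex_of_real (cond_exp_sq_root M F w x)"
    and f: "f \<in> L2 M"
  shows "AE x in M.
      w x * complex_of_real (enn2real (cond_exp_sq M F u x)) * complex_cond_exp M F (\<lambda>y. cnj (w y) * f y) x
      = cnj (u x) * complex_of_real (enn2real (cond_exp_sq M F w x)) * complex_cond_exp M F (\<lambda>y. u y * f y) x"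
proof -
  interpret adj: square_bounded_weights M F "\<lambda>x. cnj (w x)" "\<lambda>x. cnj (u x)" K
    by (rule adjoint_weights)
  note [measurable] = L2_measurable[OF f]
  let ?a = "\<lambda>x. complex_of_real (cond_exp_sq_root M F u x)"
  let ?b = "\<lambda>x. complex_of_real (cond_exp_sq_root M F w x)"
  have meas [measurable]: "?a \<in> borel_measurable F" "?b \<in> borel_measurable F"
      "?a \<in> borel_measurable M" "?b \<in> borel_measurable M"
    unfolding cond_exp_sq_root_def by measurable
  have "AE x in M. complex_cond_exp M F (\<lambda>y. ?a y * (cnj (w y) * f y)) x
      = complex_cond_exp M F (\<lambda>y. ?b y * (u y * f y)) x"
  proof (rule complex_cond_exp_cong)
    show "AE x in M. ?a x * (cnj (w x) * f x) = ?b x * (u x * f x)"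
      using eq
    proof eventually_elim
      case (elim x)
      have "?a x * (cnj (w x) * f x) = (?a x * cnj (w x)) * f x" by simp
      also have "\<dots> = ?b x * (u x * f x)" unfolding elim by simp
      finally show ?case .
    qed
  qed measurable
  moreover have "AE x in M. complex_cond_exp M F (\<lambda>y. ?a y * (cnj (w y) * f y)) x
      = ?a x * complex_cond_exp M F (\<lambda>y. cnj (w y) * f y) x"
    by (rule complex_cond_exp_mult[OF meas(1) adj.mult_L2_domain[OF f]])
  moreover have "AE x in M. complex_cond_exp M F (\<lambda>y. ?b y * (u y * f y)) x
      = ?b x * complex_cond_exp M F (\<lambda>y. u y * f y) x"
    by (rule complex_cond_exp_mult[OF meas(2) mult_L2_domain[OF f]])
  ultimately show ?thesis using eq
  proof eventually_elim
    case (elim x)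
    let ?p = "complex_cond_exp M F (\<lambda>y. cnj (w y) * f y) x"
    let ?q = "complex_cond_exp M F (\<lambda>y. u y * f y) x"
    have sq: "complex_of_real (enn2real (cond_exp_sq M F g x))
        = complex_of_real (cond_exp_sq_root M F g x) * complex_of_real (cond_exp_sq_root M F g x)" for g
      unfolding of_real_mult[symmetric] by (simp add: cond_exp_sq_root_def)
    have pq: "?a x * ?p = ?b x * ?q" using elim(1-3) by simp
    have wu: "?a x * w x = ?b x * cnj (u x)"
      using arg_cong[OF elim(4), of cnj] by (simp add: mult.commute)
    have "w x * (?a x * ?a x) * ?p = (?a x * w x) * (?a x * ?p)" by simp
    also have "\<dots> = cnj (u x) * (?b x * ?b x) * ?q" unfolding pq wu by simp
    finally show ?case unfolding sq .
  qed
qed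

text \<open>
  The constant 1 need not be square integrable, so the relation is applied to the square root \<open>s\<close> of
  a strictly positive \<open>F\<close>-measurable integrable function, which is pulled out of \<open>E\<close> and cancelled.
  Taking \<open>E\<close> of the result turns the remaining factors \<open>w\<close> and \<open>cnj u\<close> into their conditional
  expectations.
\<close>

lemma cond_exp_square_relation_if_normal_relation:
  assumes u: "u \<in> cond_exp_domain M F" and w: "w \<in> cond_exp_domain M F"
    and normal: "\<And>f. f \<in> L2 M \<Longrightarrow> AE x in M.
      w x * complex_of_real (enn2real (cond_exp_sq M F u x)) * complex_cond_exp M F (\<lambda>y. cnj (w y) * f y) x
      = cnj (u x) * complex_of_real (enn2real (cond_exp_sq M F w x)) * complex_cond_exp M F (\<lambda>y. u y * f y) x"
  shows "AE x in M. ennreal ((cmod (complex_cond_exp M F u x))\<^sup>2) * cond_exp_sq M F w x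
    = ennreal ((cmod (complex_cond_exp M F w x))\<^sup>2) * cond_exp_sq M F u x"
proof -
  let ?U = "\<lambda>x. complex_of_real (enn2real (cond_exp_sq M F u x))"
  let ?W = "\<lambda>x. complex_of_real (enn2real (cond_exp_sq M F w x))"
  let ?Eu = "complex_cond_exp M F u" and ?Ew = "complex_cond_exp M F w"
  have cnj_dom: "(\<lambda>x. cnj (g x)) \<in> cond_exp_domain M F" if "g \<in> cond_exp_domain M F" for g
    using that by (auto simp: cond_exp_domain_def)
  obtain p :: "'a \<Rightarrow> real" where p [measurable]: "p \<in> borel_measurable F"
      and p_pos: "\<And>x. p x > 0" and p_int: "integrable M p"
    by (rule obtain_positive_integrable_subalg) blast
  define s where "s x = complex_of_real (sqrt (p x))" for x
  have s_nz: "s x \<noteq> 0" for x using p_pos[of x] by (simp add: s_def)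
  have s [measurable]: "s \<in> borel_measurable F" unfolding s_def by measurable
  have "s \<in> L2 M"
    using p_int measurable_from_subalg[OF subalg s] p_pos
    by (simp add: L2_def s_def less_imp_le abs_of_pos)
  then have "AE x in M. w x * ?U x * complex_cond_exp M F (\<lambda>y. cnj (w y) * s y) x
      = cnj (u x) * ?W x * complex_cond_exp M F (\<lambda>y. u y * s y) x"
    by (rule normal)
  moreover have "AE x in M. complex_cond_exp M F (\<lambda>y. s y * cnj (w y)) x
      = s x * complex_cond_exp M F (\<lambda>y. cnj (w y)) x"
    by (rule complex_cond_exp_mult[OF s cnj_dom[OF w]])
  moreover have "AE x in M. complex_cond_exp M F (\<lambda>y. s y * u y) x = s x * ?Eu x"
    by (rule complex_cond_exp_mult[OF s u])
  ultimately have "AE x in M. ?U x * cnj (?Ew x) * w x = ?W x * ?Eu x * cnj (u x)"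
  proof eventually_elim
    case (elim x)
    have "s x * (?U x * cnj (?Ew x) * w x) = s x * (?W x * ?Eu x * cnj (u x))"
      using elim by (simp add: complex_cond_exp_cnj mult_ac)
    then show ?case using s_nz[of x] by simp
  qed
  then have "AE x in M. complex_cond_exp M F (\<lambda>y. ?U y * cnj (?Ew y) * w y) x
      = complex_cond_exp M F (\<lambda>y. ?W y * ?Eu y * cnj (u y)) x"
    by (rule complex_cond_exp_cong) measurable
  moreover have "AE x in M. complex_cond_exp M F (\<lambda>y. ?U y * cnj (?Ew y) * w y) x
      = ?U x * cnj (?Ew x) * ?Ew x"
    by (rule complex_cond_exp_mult[OF _ w]) measurable
  moreover have "AE x in M. complex_cond_exp M F (\<lambda>y. ?W y * ?Eu y * cnj (u y)) x
      = ?W x * ?Eu x * complex_cond_exp M F (\<lambda>y. cnj (u y)) x"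
    by (rule complex_cond_exp_mult[OF _ cnj_dom[OF u]]) measurable
  ultimately show ?thesis using u_finite w_finite
  proof eventually_elim
    case (elim x)
    obtain a where a: "cond_exp_sq M F u x = ennreal a" "a \<ge> 0"
      using elim(4) by (cases "cond_exp_sq M F u x") auto
    obtain b where b: "cond_exp_sq M F w x = ennreal b" "b \<ge> 0"
      using elim(5) by (cases "cond_exp_sq M F w x") auto
    have "complex_of_real (a * (cmod (?Ew x))\<^sup>2) = complex_of_real (b * (cmod (?Eu x))\<^sup>2)"
      using elim(1-3) a b unfolding of_real_mult complex_norm_square
      by (simp add: complex_cond_exp_cnj mult_ac)
    then have "a * (cmod (?Ew x))\<^sup>2 = b * (cmod (?Eu x))\<^sup>2"
      unfolding of_real_eq_iff .
    then show ?case using a b by (simp add: ennreal_mult[symmetric] mult.commute)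
  qed
qed

end

section \<open>Boundedness of the operator bounds the second moments\<close>

lemma ennreal_le_if_square_mult_le:
  fixes a c k :: ennreal
  assumes "a * a * c \<le> k * a" and "a < \<infinity>"
  shows "a * c \<le> k"
proof (cases "a = 0")
  case False
  have "a * (a * c) \<le> a * k" using assms(1) by (simp add: mult_ac)
  then show ?thesis using False assms(2) by (subst (asm) ennreal_mult_le_mult_iff) auto
qed simp

context sigma_finite_subalgebra
begin

text \<open>
  Let \<open>e\<^sub>n = E(|u|\<^sup>2; |u| \<le> n)\<close>, and test \<open>T\<close> with \<open>f = 1\<^sub>A \<surd>p cnj u\<close>, truncated to \<open>|u| \<le> n\<close>, for
  \<open>A\<close> in \<open>F\<close> and \<open>p\<close> positive, integrable and \<open>F\<close>-measurable. Then \<open>T f = w 1\<^sub>A \<surd>p e\<^sub>n\<close>, and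
  \<open>\<parallel>T f\<parallel>\<^sup>2 \<le> K \<parallel>f\<parallel>\<^sup>2\<close> says that the integral of \<open>p e\<^sub>n\<^sup>2 W\<close> over \<open>A\<close> is at most that of \<open>K p e\<^sub>n\<close>. Taking
  for \<open>A\<close> the set where the integrands are in the opposite strict order shows
  \<open>e\<^sub>n\<^sup>2 W \<le> K e\<^sub>n\<close>, hence \<open>e\<^sub>n W \<le> K\<close>, almost everywhere; and \<open>e\<^sub>n\<close> increases to \<open>U\<close>.
\<close>

lemma cond_exp_sq_bound_if_bounded:
  assumes [measurable]: "u \<in> borel_measurable M" and w [measurable]: "w \<in> borel_measurable M"
    and T: "bounded_L2_operator M (weighted_cond_exp M F w u)"
  obtains K :: real where "K \<ge> 0" "AE x in M. cond_exp_sq M F u x * cond_exp_sq M F w x \<le> ennreal K"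
proof -
  obtain C where C: "\<And>f. f \<in> L2 M \<Longrightarrow> L2_norm M (weighted_cond_exp M F w u f) \<le> C * L2_norm M f"
      and T_L2: "\<And>f. f \<in> L2 M \<Longrightarrow> weighted_cond_exp M F w u f \<in> L2 M"
    using T unfolding bounded_L2_operator_def by blast
  define K where "K = C\<^sup>2"
  have K: "K \<ge> 0" by (simp add: K_def)
  have T_le: "(\<integral>\<^sup>+x. ennreal ((cmod (weighted_cond_exp M F w u f x))\<^sup>2) \<partial>M)
      \<le> ennreal K * (\<integral>\<^sup>+x. ennreal ((cmod (f x))\<^sup>2) \<partial>M)" if f: "f \<in> L2 M" for f
  proof -
    have "(L2_norm M (weighted_cond_exp M F w u f))\<^sup>2 \<le> (C * L2_norm M f)\<^sup>2"
      using C[OF f] by (intro power_mono) (auto simp: L2_norm_def integral_nonneg_AE)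
    then show ?thesis
      by (simp add: nn_integral_L2[OF f] nn_integral_L2[OF T_L2[OF f]] K_def ennreal_mult[symmetric]
          power_mult_distrib ennreal_leI)
  qed
  obtain p :: "'a \<Rightarrow> real" where p [measurable]: "p \<in> borel_measurable F"
      and p_pos: "\<And>x. p x > 0" and p_int: "integrable M p"
    by (rule obtain_positive_integrable_subalg) blast
  note pM [measurable] = measurable_from_subalg[OF subalg p]
  define v where "v n x = (if cmod (u x) \<le> real n then (cmod (u x))\<^sup>2 else 0)" for n :: nat and x
  have v [measurable]: "v n \<in> borel_measurable M" for n unfolding v_def by measurable
  have v_nonneg: "v n x \<ge> 0" for n x by (simp add: v_def)
  have v_le: "v n x \<le> (real n)\<^sup>2" for n x by (auto simp: v_def intro: power_mono)
  define e where "e n = nn_cond_exp M F (\<lambda>y. ennreal (v n y))" for n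
  have e [measurable]: "e n \<in> borel_measurable F" "e n \<in> borel_measurable M" for n
    by (simp_all add: e_def)
  have e_finite: "AE x in M. e n x < \<infinity>" for n
  proof -
    have "AE x in M. e n x \<le> nn_cond_exp M F (\<lambda>_. ennreal ((real n)\<^sup>2)) x"
      unfolding e_def by (rule nn_cond_exp_mono) (auto intro!: ennreal_leI v_le)
    moreover have "AE x in M. ennreal ((real n)\<^sup>2) = nn_cond_exp M F (\<lambda>_. ennreal ((real n)\<^sup>2)) x"
      by (rule nn_cond_exp_F_meas) simp
    ultimately show ?thesis
    proof eventually_elim
      case (elim x)
      then show ?case by (metis ennreal_less_top infinity_ennreal_def le_less_trans)
    qed
  qed
  have trunc_bound: "AE x in M. e n x * cond_exp_sq M F w x \<le> ennreal K" for n
  proof -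
    \<comment> \<open>A real valued version of \<open>e n\<close>, since \<open>E(u f)\<close> is a complex function.\<close>
    define r where "r x = enn2real (e n x)" for x
    have r [measurable]: "r \<in> borel_measurable F" "r \<in> borel_measurable M"
      unfolding r_def by measurable
    have r_nonneg: "r x \<ge> 0" for x by (simp add: r_def)
    define A where "A = {x \<in> space F. ennreal K * ennreal (r x) < ennreal ((r x)\<^sup>2) * cond_exp_sq M F w x}"
    have A [measurable]: "A \<in> sets F" unfolding A_def by measurable
    then have [measurable]: "A \<in> sets M" using subalg by (auto simp: subalgebra_def)
    define h where "h x = complex_of_real (indicator A x * sqrt (p x))" for x
    have h [measurable]: "h \<in> borel_measurable F" "h \<in> borel_measurable M"
      unfolding h_def by measurable
    have h_sq: "(cmod (h x))\<^sup>2 = indicator A x * p x" for x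
      using p_pos[of x] by (auto simp: h_def indicator_def less_imp_le)
    define f where "f x = h x * (if cmod (u x) \<le> real n then cnj (u x) else 0)" for x
    have f_sq: "(cmod (f x))\<^sup>2 = indicator A x * p x * v n x" for x
      unfolding f_def norm_mult power_mult_distrib h_sq by (simp add: v_def)
    have f: "f \<in> L2 M"
    proof -
      have [measurable]: "f \<in> borel_measurable M" unfolding f_def by measurable
      have "integrable M (\<lambda>x. indicator A x * p x * v n x)"
      proof (rule Bochner_Integration.integrable_bound)
        show "integrable M (\<lambda>x. (real n)\<^sup>2 * p x)" using p_int by simp
        show "AE x in M. norm (indicator A x * p x * v n x) \<le> norm ((real n)\<^sup>2 * p x)"
        proof (intro AE_I2)
          fix x
          have "p x * v n x \<le> p x * (real n)\<^sup>2"
            using p_pos[of x] v_le by (intro mult_left_mono) (auto simp: less_imp_le)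
          then show "norm (indicator A x * p x * v n x) \<le> norm ((real n)\<^sup>2 * p x)"
            using p_pos[of x] v_nonneg[of n x]
            by (auto simp: indicator_def abs_mult abs_of_pos mult.commute)
        qed
      qed measurable
      then show ?thesis by (simp add: L2_def f_sq)
    qed
    have Tf: "AE x in M. weighted_cond_exp M F w u f x = w x * (h x * complex_of_real (r x))"
    proof -
      have arg: "(\<lambda>y. u y * f y) = (\<lambda>y. h y * complex_of_real (v n y))"
        by (auto simp: fun_eq_iff f_def v_def complex_norm_square simp del: of_real_power)
      have "AE x in M. nn_cond_exp M F (\<lambda>y. ennreal (cmod (complex_of_real (v n y)))) x < \<infinity>"
        using e_finite[of n] by (simp add: e_def abs_of_nonneg v_nonneg)
      then have "(\<lambda>x. complex_of_real (v n x)) \<in> cond_exp_domain M F"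
        by (simp add: cond_exp_domain_def)
      then have "AE x in M. complex_cond_exp M F (\<lambda>y. h y * complex_of_real (v n y)) x
          = h x * complex_cond_exp M F (\<lambda>y. complex_of_real (v n y)) x"
        by (rule complex_cond_exp_mult[OF h(1)])
      moreover have "AE x in M. complex_cond_exp M F (\<lambda>y. complex_of_real (v n y)) x
          = complex_of_real (r x)"
        unfolding r_def e_def by (rule complex_cond_exp_of_nonneg) (auto simp: v_nonneg)
      ultimately show ?thesis
        unfolding weighted_cond_exp_def arg by eventually_elim simp
    qed
    let ?low = "\<lambda>x. ennreal (indicator A x * p x) * (ennreal K * ennreal (r x))"
    let ?high = "\<lambda>x. ennreal (indicator A x * p x) * (ennreal ((r x)\<^sup>2) * cond_exp_sq M F w x)"
    have low: "(\<integral>\<^sup>+x. ?low x \<partial>M) = ennreal K * (\<integral>\<^sup>+x. ennreal ((cmod (f x))\<^sup>2) \<partial>M)"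
    proof -
      have "(\<integral>\<^sup>+x. ?low x \<partial>M) = (\<integral>\<^sup>+x. (ennreal K * ennreal (indicator A x * p x)) * e n x \<partial>M)"
        by (rule nn_integral_cong_AE, use e_finite[of n] in eventually_elim)
          (simp add: r_def ennreal_enn2real mult_ac)
      also have "\<dots> = (\<integral>\<^sup>+x. (ennreal K * ennreal (indicator A x * p x)) * ennreal (v n x) \<partial>M)"
        unfolding e_def by (rule nn_cond_exp_intg) measurable
      also have "\<dots> = (\<integral>\<^sup>+x. ennreal K * ennreal ((cmod (f x))\<^sup>2) \<partial>M)"
        using p_pos by (simp add: f_sq ennreal_mult less_imp_le v_nonneg mult.assoc)
      also have "\<dots> = ennreal K * (\<integral>\<^sup>+x. ennreal ((cmod (f x))\<^sup>2) \<partial>M)"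
        using L2_measurable[OF f] by (intro nn_integral_cmult) simp
      finally show ?thesis .
    qed
    have "(\<integral>\<^sup>+x. ?high x \<partial>M)
        = (\<integral>\<^sup>+x. ennreal ((cmod (h x * complex_of_real (r x)))\<^sup>2) * cond_exp_sq M F w x \<partial>M)"
      using p_pos r_nonneg unfolding norm_mult power_mult_distrib h_sq
      by (simp add: ennreal_mult less_imp_le mult.assoc)
    also have "\<dots> = (\<integral>\<^sup>+x. ennreal ((cmod (w x * (h x * complex_of_real (r x))))\<^sup>2) \<partial>M)"
      by (rule nn_integral_cond_exp_sq_mult[symmetric]) measurable
    also have "\<dots> = (\<integral>\<^sup>+x. ennreal ((cmod (weighted_cond_exp M F w u f x))\<^sup>2) \<partial>M)"
      by (rule nn_integral_cong_AE) (use Tf in \<open>auto elim: eventually_mono\<close>)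
    also have "\<dots> \<le> (\<integral>\<^sup>+x. ?low x \<partial>M)"
      using T_le[OF f] low by simp
    finally have high_le: "(\<integral>\<^sup>+x. ?high x \<partial>M) \<le> (\<integral>\<^sup>+x. ?low x \<partial>M)" .
    have "AE x in M. ?high x \<le> ?low x"
    proof (rule ccontr)
      assume not: "\<not> (AE x in M. ?high x \<le> ?low x)"
      have "(\<integral>\<^sup>+x. ?low x \<partial>M) < (\<integral>\<^sup>+x. ?high x \<partial>M)"
      proof (rule nn_integral_less[OF _ _ _ _ not])
        show "(\<integral>\<^sup>+x. ?low x \<partial>M) \<noteq> \<infinity>"
          unfolding low nn_integral_L2[OF f] by (simp add: ennreal_mult_eq_top_iff)
        show "AE x in M. ?low x \<le> ?high x"
          by (intro AE_I2) (auto simp: A_def indicator_def intro!: mult_left_mono)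
      qed measurable
      then show False using high_le by simp
    qed
    then have "AE x in M. x \<notin> A"
    proof eventually_elim
      case (elim x)
      show ?case
      proof
        assume x: "x \<in> A"
        then have "?low x < ?high x"
          using p_pos[of x] by (auto simp: A_def intro!: ennreal_mult_strict_left_mono)
        then show False using elim by simp
      qed
    qed
    then show ?thesis using e_finite[of n] AE_space
    proof eventually_elim
      case (elim x)
      have "ennreal (r x) = e n x" using elim(2) by (simp add: r_def ennreal_enn2real)
      moreover have "ennreal ((r x)\<^sup>2) * cond_exp_sq M F w x \<le> ennreal K * ennreal (r x)"
        using elim(1,3) subalg by (auto simp: A_def subalgebra_def not_less)
      moreover have "ennreal ((r x)\<^sup>2) = ennreal (r x) * ennreal (r x)"
        by (simp add: power2_eq_square ennreal_mult r_nonneg)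
      ultimately have "e n x * e n x * cond_exp_sq M F w x \<le> ennreal K * e n x" by metis
      then show ?case using elim(2) by (rule ennreal_le_if_square_mult_le)
    qed
  qed
  have "AE x in M. cond_exp_sq M F u x = (SUP n. e n x)"
  proof -
    have sup: "ennreal ((cmod (u x))\<^sup>2) = (SUP n. ennreal (v n x))" for x
    proof (rule antisym)
      obtain n :: nat where "cmod (u x) \<le> real n" using real_arch_simple by blast
      then have "ennreal ((cmod (u x))\<^sup>2) = ennreal (v n x)" by (simp add: v_def)
      then show "ennreal ((cmod (u x))\<^sup>2) \<le> (SUP n. ennreal (v n x))"
        by (metis SUP_upper UNIV_I)
      show "(SUP n. ennreal (v n x)) \<le> ennreal ((cmod (u x))\<^sup>2)"
        by (intro SUP_least ennreal_leI) (simp add: v_def)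
    qed
    have "incseq (\<lambda>n x. ennreal (v n x))"
      by (intro incseq_SucI le_funI ennreal_leI) (auto simp: v_def)
    then show ?thesis
      unfolding cond_exp_sq_def sup e_def by (intro nn_cond_exp_SUP) auto
  qed
  moreover have "AE x in M. \<forall>n. e n x * cond_exp_sq M F w x \<le> ennreal K"
    using trunc_bound by (simp add: AE_all_countable)
  ultimately have "AE x in M. cond_exp_sq M F u x * cond_exp_sq M F w x \<le> ennreal K"
  proof eventually_elim
    case (elim x)
    have "cond_exp_sq M F u x * cond_exp_sq M F w x = (SUP n. e n x * cond_exp_sq M F w x)"
      unfolding elim(1) by (simp add: SUP_mult_left_ennreal mult.commute)
    also have "\<dots> \<le> ennreal K" using elim(2) by (intro SUP_least) auto
    finally show ?case .
  qed
  then show thesis using that K by blast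
qed

end

section \<open>Cutting off the infinite second moments\<close>

context sigma_finite_subalgebra
begin

lemma cond_exp_sq_mult:
  assumes a [measurable]: "a \<in> borel_measurable F" and [measurable]: "f \<in> borel_measurable M"
  shows "AE x in M. cond_exp_sq M F (\<lambda>y. a y * f y) x = ennreal ((cmod (a x))\<^sup>2) * cond_exp_sq M F f x"
proof -
  have "AE x in M. ennreal ((cmod (a x))\<^sup>2) * nn_cond_exp M F (\<lambda>y. ennreal ((cmod (f y))\<^sup>2)) x
      = nn_cond_exp M F (\<lambda>y. ennreal ((cmod (a y))\<^sup>2) * ennreal ((cmod (f y))\<^sup>2)) x"
    by (rule nn_cond_exp_prod) measurable
  then show ?thesis
    by eventually_elim (simp add: cond_exp_sq_def norm_mult power_mult_distrib ennreal_mult)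
qed

lemma complex_cond_exp_zero_where_zero:
  assumes f: "f \<in> cond_exp_domain M F" and P [measurable]: "Measurable.pred F P"
    and zero: "AE x in M. P x \<longrightarrow> f x = 0"
  shows "AE x in M. P x \<longrightarrow> complex_cond_exp M F f x = 0"
proof -
  note [measurable] = cond_exp_domain_measurable[OF f] measurable_from_subalg[OF subalg P]
  define a where "a x = (if P x then 1 else 0 :: complex)" for x
  have a [measurable]: "a \<in> borel_measurable F" "a \<in> borel_measurable M"
    unfolding a_def by measurable
  have "AE x in M. complex_cond_exp M F (\<lambda>y. a y * f y) x = complex_cond_exp M F (\<lambda>y. 0 * f y) x"
    by (rule complex_cond_exp_cong) (use zero in \<open>auto simp: a_def elim: eventually_mono\<close>)
  moreover have "AE x in M. complex_cond_exp M F (\<lambda>y. a y * f y) x = a x * complex_cond_exp M F f x"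
    by (rule complex_cond_exp_mult[OF a(1) f])
  moreover have "AE x in M. complex_cond_exp M F (\<lambda>y. 0 * f y) x = 0 * complex_cond_exp M F f x"
    by (rule complex_cond_exp_mult[OF _ f]) simp
  ultimately show ?thesis
  proof eventually_elim
    case (elim x)
    then have "a x * complex_cond_exp M F f x = 0" by (metis mult_zero_left)
    then show ?case by (auto simp: a_def split: if_splits)
  qed
qed

text \<open>
  In the extended nonnegative reals, \<open>U \<infinity>\<close> is bounded by a real number only if \<open>U = 0\<close>.
\<close>

lemma zero_where_cond_exp_sq_infinite:
  assumes [measurable]: "u \<in> borel_measurable M"
    and bound: "AE x in M. cond_exp_sq M F u x * cond_exp_sq M F w x \<le> ennreal K"
  shows "AE x in M. cond_exp_sq M F w x = \<infinity> \<longrightarrow> u x = 0 \<and> cond_exp_sq M F u x = 0"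
proof -
  have U: "AE x in M. cond_exp_sq M F w x = \<infinity> \<longrightarrow> cond_exp_sq M F u x = 0"
    using bound
  proof eventually_elim
    case (elim x)
    then show ?case by (auto simp: ennreal_mult_top top_unique split: if_splits)
  qed
  have "AE x in M. cond_exp_sq M F w x = \<infinity> \<longrightarrow> ennreal ((cmod (u x))\<^sup>2) = 0"
    by (rule AE_zero_if_nn_cond_exp_zero) (use U in \<open>simp_all add: cond_exp_sq_def\<close>)
  then show ?thesis using U by eventually_elim simp
qed

end

theorem theorem3p5:
  fixes M F :: "'a measure" and u w :: "'a \<Rightarrow> complex"
  assumes "complete_measure M"
    and "sigma_finite_measure M"
    and "sigma_finite_subalgebra M F"
    and "u \<in> cond_exp_domain M F"
    and "w \<in> cond_exp_domain M F"
    and "\<And>f. f \<in> L2 M \<Longrightarrow> (\<lambda>x. u x * f x) \<in> cond_exp_domain M F"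
    and "bounded_L2_operator M (weighted_cond_exp M F w u)"
  shows "((AE x in M. complex_of_real (cond_exp_sq_root M F u x) * cnj (w x)
                    = u x * complex_of_real (cond_exp_sq_root M F w x))
           \<longrightarrow> normal_L2_operator M (weighted_cond_exp M F w u))
       \<and> (normal_L2_operator M (weighted_cond_exp M F w u)
           \<longrightarrow> (AE x in M. ennreal ((cmod (complex_cond_exp M F u x))\<^sup>2) * cond_exp_sq M F w x
                         = ennreal ((cmod (complex_cond_exp M F w x))\<^sup>2) * cond_exp_sq M F u x))"
proof -
  interpret sigma_finite_subalgebra M F by (rule assms(3))
  note u = assms(4) and w = assms(5) and T = assms(7)
  note [measurable] = cond_exp_domain_measurable[OF u] cond_exp_domain_measurable[OF w]
  let ?U = "cond_exp_sq M F u" and ?W = "cond_exp_sq M F w"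
  obtain K where K: "K \<ge> 0" and bound: "AE x in M. ?U x * ?W x \<le> ennreal K"
    using cond_exp_sq_bound_if_bounded[OF cond_exp_domain_measurable[OF u]
        cond_exp_domain_measurable[OF w] T] by blast
  then have bound': "AE x in M. ?W x * ?U x \<le> ennreal K" by (simp add: mult.commute)
  have u_zero: "AE x in M. ?W x = \<infinity> \<longrightarrow> u x = 0 \<and> ?U x = 0"
    by (rule zero_where_cond_exp_sq_infinite[OF _ bound]) measurable
  have w_zero: "AE x in M. ?U x = \<infinity> \<longrightarrow> w x = 0 \<and> ?W x = 0"
    by (rule zero_where_cond_exp_sq_infinite[OF _ bound']) measurable

  \<comment> \<open>Cutting off \<open>u\<close> and \<open>w\<close> outside \<open>{U < \<infinity>, W < \<infinity>}\<close> makes the second moments finite and leaves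
    the operator unchanged.\<close>
  define c where "c x = (if ?U x < \<infinity> \<and> ?W x < \<infinity> then 1 else 0 :: complex)" for x
  have c [measurable]: "c \<in> borel_measurable F" "c \<in> borel_measurable M"
    unfolding c_def by measurable
  define u' where "u' x = c x * u x" for x
  define w' where "w' x = c x * w x" for x
  have sq_u': "AE x in M. cond_exp_sq M F u' x = ennreal ((cmod (c x))\<^sup>2) * ?U x"
    unfolding u'_def[abs_def] by (rule cond_exp_sq_mult) measurable
  have sq_w': "AE x in M. cond_exp_sq M F w' x = ennreal ((cmod (c x))\<^sup>2) * ?W x"
    unfolding w'_def[abs_def] by (rule cond_exp_sq_mult) measurable
  interpret cut: square_bounded_weights M F u' w' K
  proof
    show "u' \<in> borel_measurable M" "w' \<in> borel_measurable M"
      unfolding u'_def[abs_def] w'_def[abs_def] by measurable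
    show "AE x in M. cond_exp_sq M F u' x < \<infinity>"
      using sq_u' by eventually_elim (simp add: c_def)
    show "AE x in M. cond_exp_sq M F w' x < \<infinity>"
      using sq_w' by eventually_elim (simp add: c_def)
    show "AE x in M. cond_exp_sq M F u' x * cond_exp_sq M F w' x \<le> ennreal K"
      using sq_u' sq_w' bound by eventually_elim (simp add: c_def)
  qed (rule K)
  have T_eq: "AE x in M. weighted_cond_exp M F w u f x = weighted_cond_exp M F w' u' f x"
    if f: "f \<in> L2 M" for f
  proof -
    have uf: "(\<lambda>x. u x * f x) \<in> cond_exp_domain M F" by (rule assms(6)[OF f])
    have "AE x in M. complex_cond_exp M F (\<lambda>y. u' y * f y) x
        = c x * complex_cond_exp M F (\<lambda>y. u y * f y) x"
      using complex_cond_exp_mult[OF c(1) uf] by (simp add: u'_def mult.assoc)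
    moreover have "AE x in M. ?W x = \<infinity> \<longrightarrow> complex_cond_exp M F (\<lambda>y. u y * f y) x = 0"
      by (rule complex_cond_exp_zero_where_zero[OF uf]) (use u_zero in \<open>auto elim: eventually_mono\<close>)
    ultimately show ?thesis using w_zero
    proof eventually_elim
      case (elim x)
      then show ?case
        by (cases "?U x = \<infinity>"; cases "?W x = \<infinity>")
          (simp_all add: weighted_cond_exp_def w'_def c_def less_top)
    qed
  qed

  have "normal_L2_operator M (weighted_cond_exp M F w u)"
    if eq: "AE x in M. complex_of_real (cond_exp_sq_root M F u x) * cnj (w x)
      = u x * complex_of_real (cond_exp_sq_root M F w x)"
  proof -
    have "AE x in M. complex_of_real (cond_exp_sq_root M F u' x) * cnj (w' x)
        = u' x * complex_of_real (cond_exp_sq_root M F w' x)"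
      using eq sq_u' sq_w'
      by eventually_elim (simp add: cond_exp_sq_root_def u'_def w'_def c_def)
    then show ?thesis
      using cut.normal_relation_if_proportional cut.normal_iff[OF T T_eq] by blast
  qed
  moreover have "AE x in M. ennreal ((cmod (complex_cond_exp M F u x))\<^sup>2) * ?W x
      = ennreal ((cmod (complex_cond_exp M F w x))\<^sup>2) * ?U x"
    if "normal_L2_operator M (weighted_cond_exp M F w u)"
  proof -
    have "u' \<in> cond_exp_domain M F" "w' \<in> cond_exp_domain M F"
      unfolding u'_def[abs_def] w'_def[abs_def] by (rule cond_exp_domain_mult[OF c(1)]; fact)+
    then have "AE x in M. ennreal ((cmod (complex_cond_exp M F u' x))\<^sup>2) * cond_exp_sq M F w' x
        = ennreal ((cmod (complex_cond_exp M F w' x))\<^sup>2) * cond_exp_sq M F u' x"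
      using that cut.normal_iff[OF T T_eq]
      by (intro cut.cond_exp_square_relation_if_normal_relation) blast+
    moreover have "AE x in M. complex_cond_exp M F u' x = c x * complex_cond_exp M F u x"
      unfolding u'_def[abs_def] by (rule complex_cond_exp_mult[OF c(1) u])
    moreover have "AE x in M. complex_cond_exp M F w' x = c x * complex_cond_exp M F w x"
      unfolding w'_def[abs_def] by (rule complex_cond_exp_mult[OF c(1) w])
    moreover have "AE x in M. ?W x = \<infinity> \<longrightarrow> complex_cond_exp M F u x = 0"
      by (rule complex_cond_exp_zero_where_zero[OF u]) (use u_zero in \<open>auto elim: eventually_mono\<close>)
    moreover have "AE x in M. ?U x = \<infinity> \<longrightarrow> complex_cond_exp M F w x = 0"
      by (rule complex_cond_exp_zero_where_zero[OF w]) (use w_zero in \<open>auto elim: eventually_mono\<close>)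
    ultimately show ?thesis using sq_u' sq_w' u_zero w_zero
    proof eventually_elim
      case (elim x)
      then show ?case
        by (cases "?U x = \<infinity>"; cases "?W x = \<infinity>") (simp_all add: c_def less_top)
    qed
  qed
  ultimately show ?thesis by blast
qed

end
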